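(* Assume $q\ge n$, and let $k,r$ be divisors of $n$. Let $m$ be an $\mathbb{F}_{q^k}$-subline of $\mathrm{PG}(2,q^n)$ external to $l_\infty$ such that the smallest subline containing $m$ and tangent to $l_\infty$ is an $\mathbb{F}_{q^r}$-subline. Then $M=\phi(m)$ is a set of $q^k+1$ affine points of $\Sigma$, no three collinear, contained in an $r$-dimensional subspace of $\Sigma$ meeting $H_\infty$ in an element of $\mathcal D_r$, and any three points of $M$ lie on a normal rational curve of $\Sigma$ all of whose points belong to $M$.
   Context: Let $q$ be a prime power and $n\ge1$. Points of $\mathrm{PG}(2,q^n)$ are written $(a,b,c)_{\mathbb{F}_{q^n}}$; $l_\infty$ is the line $c=0$. For $j\mid n$, an $\mathbb{F}_{q^j}$-subline is a set $\{(su+tv)_{\mathbb{F}_{q^n}}:(s,t)\in\mathbb{F}_{q^j}^2\setminus\{(0,0)\}\}$ for $\mathbb{F}_{q^n}$-independent $u,v\in\mathbb{F}_{q^n}^3$; external to $l_\infty$ means no point on $l_\infty$, tangent means exactly one; "smallest" means over the smallest subfield. Let $\Sigma=\mathrm{PG}(2n,q)$ be the projective space of the $\mathbb{F}_q$-vector space $\mathbb{F}_{q^n}\times\mathbb{F}_{q^n}\times\mathbb{F}_q$, points $(a,b,c)_{\mathbb{F}_q}$; $H_\infty$ is the hyperplane $c=0$, points off it are affine. For $k\mid n$, $\mathcal D_k=\{\{(ax,bx,0)_{\mathbb{F}_q}:x\in\mathbb{F}_{q^k}^*\}:(a,b)\in\mathbb{F}_{q^n}^2\setminus\{(0,0)\}\}$.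 The ABB-map $\phi$ sends an affine point $(a,b,1)_{\mathbb{F}_{q^n}}$ to $(a,b,1)_{\mathbb{F}_q}$. A normal rational curve of degree $d$ ($1\le d\le q$) is a set $\{(\sum_{i=0}^d s^{d-i}t^ie_i)_{\mathbb{F}_q}:(s,t)\in\mathbb{F}_q^2\setminus\{(0,0)\}\}$ for linearly independent $e_0,\dots,e_d$. *)

theory Defs
  imports Main "HOL-Computational_Algebra.Primes"
begin

text \<open>Vectors are triples over the field 'a of order q^n.
  The subfield F_{q^j} is the set of fixed points of x |-> x^(q^j).\<close>

type_synonym 'a vec3 = "'a \<times> 'a \<times> 'a"

definition subf :: "nat \<Rightarrow> nat \<Rightarrow> 'a::field set" where
  "subf q j = {x. x ^ (q ^ j) = x}"

definition vsmul :: "'a::field \<Rightarrow> 'a vec3 \<Rightarrow> 'a vec3" where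
  "vsmul c w = (c * fst w, c * fst (snd w), c * snd (snd w))"

definition vadd :: "'a::field vec3 \<Rightarrow> 'a vec3 \<Rightarrow> 'a vec3" where
  "vadd u v = (fst u + fst v, fst (snd u) + fst (snd v), snd (snd u) + snd (snd v))"

text \<open>Points of PG(2,q^n): (w)_{F_{q^n}} for nonzero w.\<close>
definition ptN :: "'a::field vec3 \<Rightarrow> 'a vec3 set" where
  "ptN w = {vsmul c w | c. c \<noteq> 0}"

text \<open>Points of Sigma = PG(2n,q): (w)_{F_q}, for nonzero w with third coordinate in F_q.\<close>
definition ptS :: "nat \<Rightarrow> 'a::field vec3 \<Rightarrow> 'a vec3 set" where
  "ptS q w = {vsmul c w | c. c \<in> subf q 1 \<and> c \<noteq> 0}"

definition inV :: "nat \<Rightarrow> 'a::field vec3 \<Rightarrow> bool" where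
  "inV q w \<longleftrightarrow> snd (snd w) \<in> subf q 1"

definition Sigma_points :: "nat \<Rightarrow> 'a::field vec3 set set" where
  "Sigma_points q = {ptS q w | w. inV q w \<and> w \<noteq> (0, 0, 0)}"

definition affine_Sigma_point :: "nat \<Rightarrow> 'a::field vec3 set \<Rightarrow> bool" where
  "affine_Sigma_point q P \<longleftrightarrow> (\<exists>w. inV q w \<and> snd (snd w) \<noteq> 0 \<and> P = ptS q w)"

definition indepN :: "'a::field vec3 \<Rightarrow> 'a vec3 \<Rightarrow> bool" where
  "indepN u v \<longleftrightarrow> (\<forall>a b. vadd (vsmul a u) (vsmul b v) = (0, 0, 0) \<longrightarrow> a = 0 \<and> b = 0)"

definition subline :: "nat \<Rightarrow> nat \<Rightarrow> 'a::field vec3 \<Rightarrow> 'a vec3 \<Rightarrow> 'a vec3 set set" where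
  "subline q j u v = {ptN (vadd (vsmul s u) (vsmul t v)) | s t.
      s \<in> subf q j \<and> t \<in> subf q j \<and> (s, t) \<noteq> (0, 0)}"

definition is_subline :: "nat \<Rightarrow> nat \<Rightarrow> 'a::field vec3 set set \<Rightarrow> bool" where
  "is_subline q j m \<longleftrightarrow> (\<exists>u v. indepN u v \<and> m = subline q j u v)"

definition on_linf :: "'a::field vec3 set \<Rightarrow> bool" where
  "on_linf P \<longleftrightarrow> (\<exists>a b. (a, b) \<noteq> (0, 0) \<and> P = ptN (a, b, 0))"

definition external_linf :: "'a::field vec3 set set \<Rightarrow> bool" where
  "external_linf m \<longleftrightarrow> (\<forall>P\<in>m. \<not> on_linf P)"

definition tangent_linf :: "'a::field vec3 set set \<Rightarrow> bool" where
  "tangent_linf m \<longleftrightarrow> (\<exists>!P. P \<in> m \<and> on_linf P)"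

text \<open>The ABB-map on affine points (a,b,1)_{F_{q^n}}.\<close>
definition phi :: "nat \<Rightarrow> 'a::field vec3 set \<Rightarrow> 'a vec3 set" where
  "phi q P = ptS q (THE w. \<exists>a b. w = (a, b, 1) \<and> P = ptN w)"

definition lincomb :: "'a::field list \<Rightarrow> 'a vec3 list \<Rightarrow> 'a vec3" where
  "lincomb cs ws = ((\<Sum>i<length ws. cs ! i * fst (ws ! i)),
                    (\<Sum>i<length ws. cs ! i * fst (snd (ws ! i))),
                    (\<Sum>i<length ws. cs ! i * snd (snd (ws ! i))))"

definition indepQ :: "nat \<Rightarrow> 'a::field vec3 list \<Rightarrow> bool" where
  "indepQ q ws \<longleftrightarrow> (\<forall>cs. length cs = length ws \<and> set cs \<subseteq> subf q 1 \<and> lincomb cs ws = (0, 0, 0)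
      \<longrightarrow> set cs \<subseteq> {0})"

definition spanQ :: "nat \<Rightarrow> 'a::field vec3 list \<Rightarrow> 'a vec3 set" where
  "spanQ q ws = {lincomb cs ws | cs. length cs = length ws \<and> set cs \<subseteq> subf q 1}"

definition proj_span :: "nat \<Rightarrow> 'a::field vec3 list \<Rightarrow> 'a vec3 set set" where
  "proj_span q ws = {ptS q w | w. w \<in> spanQ q ws \<and> w \<noteq> (0, 0, 0)}"

definition subspace_dim :: "nat \<Rightarrow> nat \<Rightarrow> 'a::field vec3 set set \<Rightarrow> bool" where
  "subspace_dim q d S \<longleftrightarrow> (\<exists>ws. length ws = d + 1 \<and> (\<forall>w\<in>set ws. inV q w) \<and> indepQ q ws
      \<and> S = proj_span q ws)"

definition H_inf_points :: "nat \<Rightarrow> 'a::field vec3 set set" where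
  "H_inf_points q = {P \<in> Sigma_points q. \<exists>a b. (a, b) \<noteq> (0, 0) \<and> P = ptS q (a, b, 0)}"

text \<open>Elements of the Desarguesian spread D_k, as point sets of Sigma.\<close>
definition D_elem :: "nat \<Rightarrow> nat \<Rightarrow> 'a::field vec3 set set \<Rightarrow> bool" where
  "D_elem q k X \<longleftrightarrow> (\<exists>a b. (a, b) \<noteq> (0, 0) \<and>
      X = {ptS q (a * x, b * x, 0) | x. x \<in> subf q k \<and> x \<noteq> 0})"

definition collinear3 :: "nat \<Rightarrow> 'a::field vec3 set \<Rightarrow> 'a vec3 set \<Rightarrow> 'a vec3 set \<Rightarrow> bool" where
  "collinear3 q P1 P2 P3 \<longleftrightarrow> (\<exists>u v. inV q u \<and> inV q v \<and> {P1, P2, P3} \<subseteq> proj_span q [u, v])"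

definition nrc :: "nat \<Rightarrow> nat \<Rightarrow> 'a::field vec3 list \<Rightarrow> 'a vec3 set set" where
  "nrc q d es = {ptS q (lincomb (map (\<lambda>i. s ^ (d - i) * t ^ i) [0..<d+1]) es) | s t.
      s \<in> subf q 1 \<and> t \<in> subf q 1 \<and> (s, t) \<noteq> (0, 0)}"

definition is_nrc :: "nat \<Rightarrow> 'a::field vec3 set set \<Rightarrow> bool" where
  "is_nrc q C \<longleftrightarrow> (\<exists>d es. 1 \<le> d \<and> d \<le> q \<and> length es = d + 1 \<and> (\<forall>e\<in>set es. inV q e)
      \<and> indepQ q es \<and> C = nrc q d es)"

end

theory Submission
  imports Defs "HOL-Computational_Algebra.Polynomial"
begin

text \<open>Three distinct points of the F_{q^k}-subline m can be written as ptN A, ptN B and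
  ptN (A + B); then every point ptN (sA + tB) with s, t in F_q lies in m. Normalise B = (b1, b2, 1);
  as m is external to l_\<infinity>, the third coordinate \<mu> of A is not in F_q. Let d be the degree
  of \<mu> over F_q, so 2 \<le> d \<le> n \<le> q. Multiplying \<phi>(sA + tB) = (sA + tB) / (s\<mu> + t) by the norm
  \<Prod>i<d. (s\<mu>^(q^i) + t) of s\<mu> + t, which lies in F_q, exhibits these points as a normal
  rational curve of degree d. Its d + 1 coefficient vectors are independent over F_q by Lagrange
  interpolation at the conjugates -\<mu>^(q^i), which the Frobenius map permutes cyclically; the same
  independence shows that no three points of \<phi>(m) are collinear.

  A tangent F_{q^r}-subline containing m consists of a point D of l_\<infinity> and the points
  U + \<xi>D, \<xi> in F_{q^r}. Hence \<phi> maps m into the r-space of \<Sigma> spanned by (U, 1) and the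
  \<eta>^i D, i < r, where \<eta> generates F_{q^r} over F_q; this r-space meets H_\<infinity> in the spread
  element determined by D.\<close>

section \<open>Finite fields\<close>

lemma card_UNIV_eq_card_range_mult_card_kernel:
  fixes T :: "'a::{ab_group_add,finite} \<Rightarrow> 'a"
  assumes add: "\<And>x y. T (x + y) = T x + T y"
  shows "card (UNIV::'a set) = card (range T) * card {x. T x = 0}"
proof -
  have diff: "T (x - y) = T x - T y" for x y
    using add[of "x - y" y] by (simp add: algebra_simps)
  have fibre: "card {x. T x = y} = card {x. T x = 0}" if "y \<in> range T" for y
  proof -
    obtain x0 where y: "y = T x0" using \<open>y \<in> range T\<close> by auto
    have "{x. T x = y} = (\<lambda>z. x0 + z) ` {x. T x = 0}"
    proof (intro Set.set_eqI iffI)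
      fix x assume "x \<in> {x. T x = y}"
      hence "T (x - x0) = 0" "x = x0 + (x - x0)" using y diff by simp_all
      thus "x \<in> (\<lambda>z. x0 + z) ` {x. T x = 0}" by blast
    qed (use add y in auto)
    thus ?thesis by (simp add: card_image)
  qed
  have "UNIV = (\<Union>y\<in>range T. {x. T x = y})" by auto
  hence "card (UNIV::'a set) = card (\<Union>y\<in>range T. {x. T x = y})" by simp
  also have "\<dots> = (\<Sum>y\<in>range T. card {x. T x = y})"
    by (rule card_UN_disjoint) auto
  also have "\<dots> = card (range T) * card {x. T x = 0}" using fibre by simp
  finally show ?thesis .
qed

lemma prod_lessThan_cyclic_shift:
  assumes "g d = g 0"
  shows "(\<Prod>i<d. g (Suc i)) = (\<Prod>i<d. g i)"
proof (cases d)
  case (Suc d')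
  have "(\<Prod>i<d. g i) = g 0 * (\<Prod>i<d'. g (Suc i))" unfolding Suc by (rule prod.lessThan_Suc_shift)
  moreover have "(\<Prod>i<d. g (Suc i)) = (\<Prod>i<d'. g (Suc i)) * g d" unfolding Suc by simp
  ultimately show ?thesis using assms by (simp add: mult.commute)
qed simp

locale field_qn =
  fixes q n p e :: nat and field_type :: "'a::{field,finite} itself"
  assumes prime_p: "prime p" and e_pos: "e > 0" and q_eq: "q = p ^ e"
    and n_pos: "n \<ge> 1" and card_UNIV: "card (UNIV :: 'a set) = q ^ n"
begin

lemma q_ge_2: "q \<ge> 2"
proof -
  have "p \<ge> 2" using prime_p prime_ge_2_nat by blast
  hence "p ^ e \<ge> p ^ 1" using e_pos by (intro power_increasing) auto
  thus ?thesis using \<open>p \<ge> 2\<close> q_eq by simp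
qed

lemma q_pos: "q > 0" using q_ge_2 by simp

lemma CHAR_eq: "CHAR('a) = p"
proof -
  have prime: "prime CHAR('a)" by (simp add: prime_CHAR_semidom finite_imp_CHAR_pos)
  have "(\<Sum>y\<in>(UNIV::'a set). y + 1) = (\<Sum>y\<in>UNIV. y)"
    by (rule sum.reindex_bij_witness[of _ "\<lambda>y. y - 1" "\<lambda>y. y + 1"]) auto
  hence "of_nat (card (UNIV::'a set)) = (0::'a)" by (simp add: sum.distrib)
  hence "CHAR('a) dvd card (UNIV::'a set)" using of_nat_eq_0_iff_char_dvd by blast
  hence "CHAR('a) dvd p ^ (e * n)" using card_UNIV q_eq by (simp add: power_mult)
  hence "CHAR('a) dvd p" using prime prime_dvd_power by blast
  thus ?thesis using prime prime_p by (simp add: primes_dvd_imp_eq)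
qed

lemma prime_CHAR: "prime CHAR('a)" using CHAR_eq prime_p by simp

lemma q_power_eq_CHAR_power: "q ^ j = CHAR('a) ^ (e * j)"
  using CHAR_eq q_eq by (simp add: power_mult)

lemma frob_add: "((x::'a) + y) ^ (q ^ j) = x ^ (q ^ j) + y ^ (q ^ j)"
  by (rule freshmans_dream'[OF prime_CHAR q_power_eq_CHAR_power])

lemma frob_sum: "(sum (f :: 'b \<Rightarrow> 'a) A) ^ (q ^ j) = (\<Sum>i\<in>A. f i ^ (q ^ j))"
  by (rule freshmans_dream_sum'[OF prime_CHAR q_power_eq_CHAR_power])

lemma frob_diff: "((x::'a) - y) ^ (q ^ j) = x ^ (q ^ j) - y ^ (q ^ j)"
  using frob_add[of "x - y" y j] by (simp add: eq_diff_eq)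

lemma frob_minus: "(- (x::'a)) ^ (q ^ j) = - (x ^ (q ^ j))"
  using frob_diff[of 0 x j] by (simp add: power_0_left q_pos)

lemma frob_inj: "(x::'a) ^ (q ^ j) = y ^ (q ^ j) \<Longrightarrow> x = y"
  using frob_diff[of x y j] by simp

lemma frob_frob: "((x::'a) ^ (q ^ i)) ^ (q ^ j) = x ^ (q ^ (i + j))"
  by (simp add: power_mult[symmetric] power_add mult.commute)

lemma power_card_UNIV: "(x::'a) ^ card (UNIV :: 'a set) = x"
proof (cases "x = 0")
  case False
  have "x * (\<Prod>y\<in>UNIV-{0}. x * y) = x * x ^ (card (UNIV :: 'a set) - 1) * \<Prod>(UNIV-{0})"
    by (simp add: prod.distrib mult_ac)
  also have "x * x ^ (card (UNIV :: 'a set) - 1) = x ^ Suc (card (UNIV :: 'a set) - 1)"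
    by (subst power_Suc) auto
  also have "Suc (card (UNIV :: 'a set) - 1) = card (UNIV :: 'a set)"
    using finite_UNIV_card_ge_0[where ?'a = 'a] by simp
  also have "(\<Prod>y\<in>UNIV-{0}. x * y) = (\<Prod>y\<in>UNIV-{0}. y)"
    by (rule prod.reindex_bij_witness[of _ "\<lambda>y. y / x" "\<lambda>y. x * y"]) (use False in auto)
  finally show ?thesis by simp
qed (use finite_UNIV_card_ge_0[where ?'a = 'a] in auto)

lemma frob_n: "(x::'a) ^ (q ^ n) = x"
  using power_card_UNIV card_UNIV by simp

lemma frob_surj: "\<exists>y. (y::'a) ^ (q ^ j) = x"
proof -
  have "inj (\<lambda>y::'a. y ^ (q ^ j))" by (auto intro: injI frob_inj)
  hence "surj (\<lambda>y::'a. y ^ (q ^ j))" using finite_UNIV_inj_surj[of "\<lambda>y::'a. y ^ (q ^ j)"] by simp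
  thus ?thesis by (metis surjD)
qed

lemma conjugates_inj:
  assumes "\<forall>j. 1 \<le> j \<longrightarrow> j < d \<longrightarrow> (x::'a) ^ (q ^ j) \<noteq> x"
    and "a < d" "b < d" "x ^ (q ^ a) = x ^ (q ^ b)"
  shows "a = b"
proof -
  have False if "i < j" "j < d" "x ^ (q ^ i) = x ^ (q ^ j)" for i j
  proof -
    have "(x ^ (q ^ (j - i))) ^ (q ^ i) = x ^ (q ^ i)" using frob_frob[of x "j - i" i] that by simp
    hence "x ^ (q ^ (j - i)) = x" by (rule frob_inj)
    thus False using assms(1) that by auto
  qed
  thus ?thesis using assms(2-4) by (metis linorder_neqE_nat)
qed

lemma subf_iff: "x \<in> subf q j \<longleftrightarrow> (x::'a) ^ (q ^ j) = x" by (simp add: subf_def)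

lemma subf_0 [simp]: "(0::'a) \<in> subf q j" by (simp add: subf_iff q_pos)
lemma subf_1 [simp]: "(1::'a) \<in> subf q j" by (simp add: subf_iff)
lemma subf_add: "x \<in> subf q j \<Longrightarrow> y \<in> subf q j \<Longrightarrow> (x::'a) + y \<in> subf q j"
  by (simp add: subf_iff frob_add)
lemma subf_diff: "x \<in> subf q j \<Longrightarrow> y \<in> subf q j \<Longrightarrow> (x::'a) - y \<in> subf q j"
  by (simp add: subf_iff frob_diff)
lemma subf_minus: "x \<in> subf q j \<Longrightarrow> - (x::'a) \<in> subf q j"
  by (simp add: subf_iff frob_minus)
lemma subf_mult: "x \<in> subf q j \<Longrightarrow> y \<in> subf q j \<Longrightarrow> (x::'a) * y \<in> subf q j"
  by (simp add: subf_iff power_mult_distrib)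
lemma subf_divide: "x \<in> subf q j \<Longrightarrow> y \<in> subf q j \<Longrightarrow> (x::'a) / y \<in> subf q j"
  by (simp add: subf_iff power_divide)
lemma subf_power: "x \<in> subf q j \<Longrightarrow> (x::'a) ^ i \<in> subf q j"
  unfolding subf_iff by (metis power_mult mult.commute)
lemma subf_sum: "(\<And>i. i \<in> A \<Longrightarrow> f i \<in> subf q j) \<Longrightarrow> (sum f A :: 'a) \<in> subf q j"
  by (induction A rule: infinite_finite_induct) (auto intro: subf_add)

lemma subf_1_subf: "x \<in> subf q 1 \<Longrightarrow> (x::'a) \<in> subf q j"
proof (induction j)
  case (Suc j)
  hence "x ^ (q ^ j) = x" "x ^ q = x" by (simp_all add: subf_iff)
  thus ?case by (simp add: subf_iff power_mult mult.commute)
qed (simp add: subf_iff)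

lemma card_subf_le:
  assumes "j \<ge> 1" shows "card (subf q j :: 'a set) \<le> q ^ j"
proof -
  define P :: "'a poly" where "P = monom 1 (q ^ j) - monom 1 1"
  have "q ^ 1 \<le> q ^ j" by (rule power_increasing) (use assms q_pos in auto)
  hence qj: "q ^ j \<ge> 2" using q_ge_2 by simp
  have "coeff P (q ^ j) = 1" using qj by (simp add: P_def coeff_monom)
  moreover have "degree P \<le> q ^ j" unfolding P_def
    by (rule order.trans[OF degree_diff_le_max]) (use qj in \<open>auto simp: degree_monom_eq\<close>)
  moreover have "P \<noteq> 0" using \<open>coeff P (q ^ j) = 1\<close> by auto
  ultimately have "card {x. poly P x = 0} \<le> q ^ j"
    using card_poly_roots_bound[of P] by linarith
  moreover have "{x. poly P x = 0} = subf q j" by (auto simp: P_def poly_monom subf_iff)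
  ultimately show ?thesis by simp
qed

text \<open>The image of x \<mapsto> x^Q - x, Q = q^j, consists of roots of the trace polynomial
  \<Sum>i<l. X^(Q^i) of F_{q^n} over F_Q, where n = j l.\<close>
lemma card_range_frob_diff_le:
  assumes nl: "n = j * l" and l: "l \<ge> 1" and Q2: "q ^ j \<ge> 2"
  shows "card (range (\<lambda>x::'a. x ^ (q ^ j) - x)) \<le> q ^ (j * (l - 1))"
proof -
  define Q where "Q = q ^ j"
  have Qi: "Q ^ i = q ^ (j * i)" for i by (simp add: Q_def power_mult)
  define S :: "'a poly" where "S = (\<Sum>i<l. monom 1 (Q ^ i))"
  have rng: "range (\<lambda>x::'a. x ^ Q - x) \<subseteq> {y. poly S y = 0}"
  proof clarify
    fix x :: 'a
    have "(x ^ Q - x) ^ (Q ^ i) = x ^ (Q ^ Suc i) - x ^ (Q ^ i)" for i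
    proof -
      have "(x ^ Q - x) ^ (Q ^ i) = (x ^ Q) ^ (Q ^ i) - x ^ (Q ^ i)"
        using frob_diff[of "x ^ Q" x "j * i"] by (simp only: Qi)
      also have "(x ^ Q) ^ (Q ^ i) = x ^ (Q ^ Suc i)" by (simp add: power_mult)
      finally show ?thesis .
    qed
    hence "poly S (x ^ Q - x) = (\<Sum>i<l. x ^ (Q ^ Suc i) - x ^ (Q ^ i))"
      by (simp add: S_def poly_sum poly_monom)
    also have "\<dots> = x ^ (Q ^ l) - x ^ (Q ^ 0)" by (rule sum_lessThan_telescope)
    also have "\<dots> = 0" using frob_n by (simp add: Qi nl)
    finally show "poly S (x ^ Q - x) = 0" .
  qed
  have "coeff S (Q ^ (l - 1)) = (\<Sum>i<l. if Q ^ (l - 1) = Q ^ i then 1 else 0)"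
    by (simp add: S_def coeff_sum coeff_monom eq_commute)
  also have "\<dots> = (\<Sum>i\<in>{l - 1}. 1)"
    using l Q2 by (intro sum.mono_neutral_cong_right) (auto simp: Q_def power_inject_exp)
  finally have "S \<noteq> 0" by auto
  moreover have "degree S \<le> Q ^ (l - 1)" unfolding S_def
  proof (rule degree_sum_le)
    fix i assume "i \<in> {..<l}"
    hence "Q ^ i \<le> Q ^ (l - 1)" using Q2 by (intro power_increasing) (auto simp: Q_def)
    thus "degree (monom (1::'a) (Q ^ i)) \<le> Q ^ (l - 1)" by (simp add: degree_monom_eq)
  qed simp
  ultimately have "card {y. poly S y = 0} \<le> Q ^ (l - 1)"
    using card_poly_roots_bound le_trans by blast
  moreover have "card (range (\<lambda>x::'a. x ^ Q - x)) \<le> card {y. poly S y = 0}"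
    using rng by (intro card_mono) simp_all
  ultimately show ?thesis by (simp add: Q_def power_mult)
qed

lemma card_subf:
  assumes "j dvd n" shows "card (subf q j :: 'a set) = q ^ j"
proof -
  obtain l where nl: "n = j * l" using assms by auto
  hence j: "j \<ge> 1" and l: "l \<ge> 1" using n_pos by (auto intro!: Suc_leI)
  have "q ^ 1 \<le> q ^ j" by (rule power_increasing) (use j q_pos in auto)
  hence Q2: "q ^ j \<ge> 2" using q_ge_2 by simp
  let ?T = "\<lambda>x::'a. x ^ (q ^ j) - x"
  have "{x. ?T x = 0} = subf q j" by (auto simp: subf_iff)
  hence "q ^ (j * l) = card (range ?T) * card (subf q j :: 'a set)"
    using card_UNIV_eq_card_range_mult_card_kernel[of ?T] card_UNIV nl
    by (simp add: frob_add)
  also have "\<dots> \<le> q ^ (j * (l - 1)) * card (subf q j :: 'a set)"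
    using card_range_frob_diff_le[OF nl l Q2] by simp
  finally have "q ^ j * q ^ (j * (l - 1)) \<le> q ^ (j * (l - 1)) * card (subf q j :: 'a set)"
    using l by (cases l) (simp_all add: power_add)
  hence "q ^ j \<le> card (subf q j :: 'a set)" using q_pos by (simp add: mult.commute)
  with card_subf_le[OF j] show ?thesis by simp
qed

end

section \<open>Points, sublines and collinearity\<close>

definition lin :: "'a::field \<Rightarrow> 'a vec3 \<Rightarrow> 'a \<Rightarrow> 'a vec3 \<Rightarrow> 'a vec3" where
  "lin a u b v = vadd (vsmul a u) (vsmul b v)"

lemma vsmul_1 [simp]: "vsmul 1 w = w" by (simp add: vsmul_def)
lemma vsmul_0 [simp]: "vsmul 0 w = (0, 0, 0)" by (simp add: vsmul_def)
lemma vsmul_vsmul [simp]: "vsmul a (vsmul b w) = vsmul (a * b) w"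
  by (simp add: vsmul_def mult.assoc)
lemma vsmul_eq_0_iff: "vsmul c w = (0, 0, 0) \<longleftrightarrow> c = 0 \<or> w = (0, 0, 0)"
  by (cases w) (auto simp: vsmul_def)
lemma lin_0_left [simp]: "lin 0 u b v = vsmul b v" by (simp add: lin_def vsmul_def vadd_def)
lemma lin_0_right [simp]: "lin a u 0 v = vsmul a u" by (simp add: lin_def vsmul_def vadd_def)
lemma vsmul_lin: "vsmul c (lin a u b v) = lin (c * a) u (c * b) v"
  by (simp add: lin_def vsmul_def vadd_def algebra_simps)
lemma lin_lin: "lin a (lin a1 u b1 v) b (lin a2 u b2 v) = lin (a * a1 + b * a2) u (a * b1 + b * b2) v"
  by (simp add: lin_def vsmul_def vadd_def algebra_simps)
lemma third_lin: "snd (snd (lin a u b v)) = a * snd (snd u) + b * snd (snd v)"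
  by (simp add: lin_def vsmul_def vadd_def)

lemma indepN_lin_iff: "indepN u v \<longleftrightarrow> (\<forall>a b. lin a u b v = (0, 0, 0) \<longrightarrow> a = 0 \<and> b = 0)"
  by (simp add: indepN_def lin_def)

lemma indepN_lin_eq_0: "indepN u v \<Longrightarrow> lin a u b v = (0, 0, 0) \<Longrightarrow> a = 0 \<and> b = 0"
  by (simp add: indepN_lin_iff)

lemma indepN_lin_nonzero: "indepN u v \<Longrightarrow> (a, b) \<noteq> (0, 0) \<Longrightarrow> lin a u b v \<noteq> (0, 0, 0)"
  using indepN_lin_eq_0 by blast

lemma indepN_lin_inj:
  assumes "indepN u v" "lin a u b v = lin a' u b' v"
  shows "a = a' \<and> b = b'"
proof -
  have "lin (a - a') u (b - b') v = (0, 0, 0)"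
    using assms(2) unfolding lin_def vadd_def vsmul_def by (auto simp: algebra_simps prod_eq_iff)
  hence "a - a' = 0 \<and> b - b' = 0" by (rule indepN_lin_eq_0[OF assms(1)])
  thus ?thesis by simp
qed

lemma det2_eq_0_proportional:
  fixes s1 t1 s2 t2 :: "'a::field"
  assumes "s1 * t2 = s2 * t1" "(s1, t1) \<noteq> (0, 0)"
  shows "s2 = (if s1 = 0 then t2 / t1 else s2 / s1) * s1 \<and> t2 = (if s1 = 0 then t2 / t1 else s2 / s1) * t1"
  using assms by (auto simp: field_simps)

lemma det2_nonzero_imp_trivial_solution:
  fixes s1 t1 s2 t2 x y :: "'a::field"
  assumes "s1 * t2 - s2 * t1 \<noteq> 0" "x * s1 + y * s2 = 0" "x * t1 + y * t2 = 0"
  shows "x = 0 \<and> y = 0"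
proof -
  have "x * (s1 * t2 - s2 * t1) = t2 * (x * s1 + y * s2) - s2 * (x * t1 + y * t2)"
    "y * (s1 * t2 - s2 * t1) = s1 * (x * t1 + y * t2) - t1 * (x * s1 + y * s2)"
    by (simp_all add: algebra_simps)
  thus ?thesis using assms by simp
qed

lemma cramer2:
  fixes s1 t1 s2 t2 s3 t3 :: "'a::field"
  assumes "s1 * t2 - s2 * t1 \<noteq> 0"
  defines "a \<equiv> (s3 * t2 - s2 * t3) / (s1 * t2 - s2 * t1)"
    and "b \<equiv> (s1 * t3 - s3 * t1) / (s1 * t2 - s2 * t1)"
  shows "a * s1 + b * s2 = s3" "a * t1 + b * t2 = t3"
proof -
  let ?\<delta> = "s1 * t2 - s2 * t1"
  have "a * s1 + b * s2 = ((s3 * t2 - s2 * t3) * s1 + (s1 * t3 - s3 * t1) * s2) / ?\<delta>"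
    "a * t1 + b * t2 = ((s3 * t2 - s2 * t3) * t1 + (s1 * t3 - s3 * t1) * t2) / ?\<delta>"
    unfolding a_def b_def by (simp_all add: add_divide_distrib)
  moreover have "(s3 * t2 - s2 * t3) * s1 + (s1 * t3 - s3 * t1) * s2 = s3 * ?\<delta>"
    "(s3 * t2 - s2 * t3) * t1 + (s1 * t3 - s3 * t1) * t2 = t3 * ?\<delta>"
    by (simp_all add: algebra_simps)
  ultimately show "a * s1 + b * s2 = s3" "a * t1 + b * t2 = t3" using assms(1) by simp_all
qed

lemma ptN_self: "w \<in> ptN w" unfolding ptN_def by (rule CollectI, rule exI[of _ 1]) simp

lemma ptN_vsmul: "c \<noteq> 0 \<Longrightarrow> ptN (vsmul c w) = ptN w"
  unfolding ptN_def
proof (intro Set.set_eqI iffI)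
  fix x assume "c \<noteq> 0" "x \<in> {vsmul d w |d. d \<noteq> 0}"
  then obtain d where "x = vsmul (d / c) (vsmul c w)" "d / c \<noteq> 0" by auto
  thus "x \<in> {vsmul d (vsmul c w) |d. d \<noteq> 0}" by blast
qed auto

lemma ptN_eqD: "ptN w = ptN w' \<Longrightarrow> \<exists>c. c \<noteq> 0 \<and> w' = vsmul c w"
  using ptN_self[of w'] unfolding ptN_def by auto

lemma ptN_lin_eq_if_det2_eq_0:
  assumes "s1 * t2 = s2 * t1" "(s1, t1) \<noteq> (0, 0)" "(s2, t2) \<noteq> (0, 0)"
  shows "ptN (lin s2 u t2 v) = ptN (lin s1 u t1 v)"
proof -
  obtain c where c: "s2 = c * s1" "t2 = c * t1" using det2_eq_0_proportional[OF assms(1,2)] by blast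
  hence "c \<noteq> 0" using assms(3) by auto
  thus ?thesis using c by (simp add: ptN_vsmul flip: vsmul_lin)
qed

lemma ptN_lin_coeffs_nonzero:
  assumes "ptN (lin a x b y) \<noteq> ptN x" "ptN (lin a x b y) \<noteq> ptN y" "(a, b) \<noteq> (0, 0)"
  shows "a \<noteq> 0" "b \<noteq> 0"
proof -
  show "a \<noteq> 0"
  proof
    assume "a = 0"
    hence "ptN (lin a x b y) = ptN y" using assms(3) ptN_vsmul[of b y] by simp
    thus False using assms(2) by simp
  qed
  show "b \<noteq> 0"
  proof
    assume "b = 0"
    hence "ptN (lin a x b y) = ptN x" using \<open>a \<noteq> 0\<close> ptN_vsmul[of a x] by simp
    thus False using assms(1) by simp
  qed
qed

lemma third_nonzero_if_not_on_linf:
  assumes "w \<noteq> (0, 0, 0)" "\<not> on_linf (ptN w)"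
  shows "snd (snd w) \<noteq> 0"
  using assms unfolding on_linf_def by (cases w) auto

lemma ptN_normalize:
  assumes "snd (snd w) \<noteq> 0"
  obtains x where "ptN w = ptN x" "snd (snd x) = 1" "x = vsmul (1 / snd (snd w)) w"
  using assms ptN_vsmul[of "1 / snd (snd w)" w] by (auto simp: vsmul_def)

lemma phi_ptN_affine:
  assumes "snd (snd x) = 1"
  shows "phi q (ptN x) = ptS q x"
proof -
  have "(THE w. \<exists>a b. w = (a, b, 1) \<and> ptN x = ptN w) = x"
  proof (rule the_equality)
    show "\<exists>a b. x = (a, b, 1) \<and> ptN x = ptN x" using assms by (cases x) auto
  next
    fix w assume "\<exists>a b. w = (a, b, 1) \<and> ptN x = ptN w"
    then obtain a b where w: "w = (a, b, 1)" "ptN x = ptN w" by auto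
    then obtain c where "w = vsmul c x" using ptN_eqD by blast
    thus "w = x" using w(1) assms by (cases x) (simp add: vsmul_def)
  qed
  thus ?thesis by (simp add: phi_def)
qed

lemma subline_cases:
  assumes "P \<in> subline q j u v"
  obtains s t where "P = ptN (lin s u t v)" "s \<in> subf q j" "t \<in> subf q j" "(s, t) \<noteq> (0, 0)"
  using assms unfolding subline_def lin_def by blast

lemma ptN_lin_in_subline:
  "s \<in> subf q j \<Longrightarrow> t \<in> subf q j \<Longrightarrow> (s, t) \<noteq> (0, 0) \<Longrightarrow> ptN (lin s u t v) \<in> subline q j u v"
  unfolding subline_def lin_def by blast

lemma external_subline_affine:
  assumes "indepN u v" "external_linf (subline q j u v)" "P \<in> subline q j u v"
  obtains x where "P = ptN x" "snd (snd x) = 1"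
proof -
  obtain s t where st: "P = ptN (lin s u t v)" "(s, t) \<noteq> (0, 0)"
    using assms(3) by (rule subline_cases)
  have "snd (snd (lin s u t v)) \<noteq> 0"
    using assms st third_nonzero_if_not_on_linf[OF indepN_lin_nonzero[OF assms(1) st(2)]]
    unfolding external_linf_def by blast
  thus ?thesis using that st(1) ptN_normalize by metis
qed

lemma indepN_lin_frame:
  assumes "indepN u v" "s1 * t2 - s2 * t1 \<noteq> 0"
  shows "indepN (lin s1 u t1 v) (lin s2 u t2 v)"
  unfolding indepN_lin_iff
proof (intro allI impI)
  fix x y assume "lin x (lin s1 u t1 v) y (lin s2 u t2 v) = (0, 0, 0)"
  hence "x * s1 + y * s2 = 0 \<and> x * t1 + y * t2 = 0"
    using indepN_lin_eq_0[OF assms(1)] by (simp add: lin_lin)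
  thus "x = 0 \<and> y = 0" using det2_nonzero_imp_trivial_solution assms(2) by blast
qed

context field_qn
begin

lemma ptS_self: "(w::'a vec3) \<in> ptS q w"
  unfolding ptS_def by (rule CollectI, rule exI[of _ 1]) simp

lemma ptS_vsmul: "c \<in> subf q 1 \<Longrightarrow> c \<noteq> 0 \<Longrightarrow> ptS q (vsmul c (w::'a vec3)) = ptS q w"
  unfolding ptS_def
proof (intro Set.set_eqI iffI)
  fix x assume "c \<in> subf q 1" "c \<noteq> 0" "x \<in> {vsmul d w |d. d \<in> subf q 1 \<and> d \<noteq> 0}"
  then obtain d where "x = vsmul (d / c) (vsmul c w)" "d / c \<noteq> 0" "d / c \<in> subf q 1"
    by (auto intro: subf_divide)
  thus "x \<in> {vsmul d (vsmul c w) |d. d \<in> subf q 1 \<and> d \<noteq> 0}" by blast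
qed (auto intro: subf_mult)

lemma ptS_eqD: "ptS q w = ptS q (w'::'a vec3) \<Longrightarrow> \<exists>c. c \<in> subf q 1 \<and> c \<noteq> 0 \<and> w' = vsmul c w"
  using ptS_self[of w'] unfolding ptS_def by auto

lemma ptS_affine_inj:
  assumes "ptS q x = ptS q (x'::'a vec3)" "snd (snd x) = 1" "snd (snd x') = 1"
  shows "x = x'"
proof -
  obtain c where "x' = vsmul c x" using ptS_eqD[OF assms(1)] by blast
  with assms(2,3) show ?thesis by (cases x) (simp add: vsmul_def)
qed

lemma card_subline:
  assumes ind: "indepN u (v::'a vec3)" and j: "j dvd n"
  shows "card (subline q j u v) = q ^ j + 1"
proof -
  let ?K = "subf q j :: 'a set"
  define f where "f t = ptN (lin 1 u t v)" for t
  have "subline q j u v = insert (ptN v) (f ` ?K)"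
  proof (intro Set.set_eqI iffI)
    fix P assume "P \<in> subline q j u v"
    then obtain s t where st: "P = ptN (lin s u t v)" "s \<in> ?K" "t \<in> ?K" "(s, t) \<noteq> (0, 0)"
      by (rule subline_cases)
    show "P \<in> insert (ptN v) (f ` ?K)"
    proof (cases "s = 0")
      case True thus ?thesis using st ptN_vsmul[of t v] by simp
    next
      case False
      hence "P = f (t / s)" using st ptN_vsmul[of s "lin 1 u (t / s) v"] by (simp add: f_def vsmul_lin)
      thus ?thesis using st by (auto intro: subf_divide)
    qed
  next
    fix P assume "P \<in> insert (ptN v) (f ` ?K)"
    then consider "P = ptN v" | t where "t \<in> ?K" "P = ptN (lin 1 u t v)"
      by (auto simp: f_def)
    thus "P \<in> subline q j u v"
      by cases (use ptN_lin_in_subline[of 0 q j 1 u v] in \<open>simp_all add: ptN_lin_in_subline\<close>)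
  qed
  moreover have "inj_on f ?K"
  proof (rule inj_onI)
    fix t t' assume "f t = f t'"
    then obtain c where "lin 1 u t' v = vsmul c (lin 1 u t v)"
      unfolding f_def using ptN_eqD by blast
    hence "lin 1 u t' v = lin c u (c * t) v" by (simp add: vsmul_lin)
    from indepN_lin_inj[OF ind this] show "t = t'" by simp
  qed
  moreover have "ptN v \<notin> f ` ?K"
  proof
    assume "ptN v \<in> f ` ?K"
    then obtain t where "ptN v = ptN (lin 1 u t v)" by (auto simp: f_def)
    then obtain c where "lin 1 u t v = vsmul c v" using ptN_eqD by blast
    hence "lin 1 u t v = lin 0 u c v" by simp
    from indepN_lin_inj[OF ind this] show False by simp
  qed
  ultimately show ?thesis using card_subf[OF j] by (simp add: card_image)
qed

lemma subline_1_subset: "subline q 1 u v \<subseteq> subline q j u (v::'a vec3)"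
proof
  fix P assume "P \<in> subline q 1 u v"
  then obtain s t where "P = ptN (lin s u t v)" "s \<in> subf q 1" "t \<in> subf q 1" "(s, t) \<noteq> (0, 0)"
    by (rule subline_cases)
  thus "P \<in> subline q j u v" by (simp add: ptN_lin_in_subline subf_1_subf)
qed

lemma subline_frame_subset:
  assumes "s1 \<in> subf q j" "t1 \<in> subf q j" "s2 \<in> subf q j" "t2 \<in> subf q j"
    and det: "s1 * t2 - s2 * t1 \<noteq> 0"
  shows "subline q j (lin s1 u t1 v) (lin s2 u t2 v) \<subseteq> subline q j u (v::'a vec3)"
proof
  fix P assume "P \<in> subline q j (lin s1 u t1 v) (lin s2 u t2 v)"
  then obtain s t where st: "P = ptN (lin s (lin s1 u t1 v) t (lin s2 u t2 v))"
    "s \<in> subf q j" "t \<in> subf q j" "(s, t) \<noteq> (0, 0)"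
    by (rule subline_cases)
  have "(s * s1 + t * s2, s * t1 + t * t2) \<noteq> (0, 0)"
    using det2_nonzero_imp_trivial_solution[OF det, of s t] st(4) by auto
  moreover have "s * s1 + t * s2 \<in> subf q j" "s * t1 + t * t2 \<in> subf q j"
    using assms st by (auto intro!: subf_add subf_mult)
  ultimately show "P \<in> subline q j u v"
    unfolding st(1) lin_lin by (rule ptN_lin_in_subline[rotated 2])
qed

lemma subline_frame_eq:
  assumes ind: "indepN u (v::'a vec3)"
    and coords: "s1 \<in> subf q j" "t1 \<in> subf q j" "s2 \<in> subf q j" "t2 \<in> subf q j"
    and det: "s1 * t2 - s2 * t1 \<noteq> 0"
  shows "subline q j (lin s1 u t1 v) (lin s2 u t2 v) = subline q j u v"
proof
  define \<delta> where "\<delta> = s1 * t2 - s2 * t1"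
  let ?A = "lin s1 u t1 v" and ?B = "lin s2 u t2 v"
  have \<delta>: "\<delta> \<noteq> 0" using det by (simp add: \<delta>_def)
  have coeffs: "t2 / \<delta> * s1 + - t1 / \<delta> * s2 = 1" "t2 / \<delta> * t1 + - t1 / \<delta> * t2 = 0"
    "- s2 / \<delta> * s1 + s1 / \<delta> * s2 = 0" "- s2 / \<delta> * t1 + s1 / \<delta> * t2 = 1"
    using \<delta> by (simp_all add: field_simps) (simp_all add: \<delta>_def algebra_simps)
  have "u = lin (t2 / \<delta>) ?A (- t1 / \<delta>) ?B" "v = lin (- s2 / \<delta>) ?A (s1 / \<delta>) ?B"
    by (simp_all only: lin_lin coeffs) simp_all
  moreover have "t2 / \<delta> * (s1 / \<delta>) - - s2 / \<delta> * (- t1 / \<delta>) = (t2 / \<delta> * s1 + - t1 / \<delta> * s2) / \<delta>"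
    using \<delta> by (simp add: field_simps)
  hence "t2 / \<delta> * (s1 / \<delta>) - - s2 / \<delta> * (- t1 / \<delta>) \<noteq> 0" using coeffs(1) \<delta> by simp
  moreover have "t2 / \<delta> \<in> subf q j" "- t1 / \<delta> \<in> subf q j" "- s2 / \<delta> \<in> subf q j" "s1 / \<delta> \<in> subf q j"
    using coords by (auto simp: \<delta>_def intro!: subf_divide subf_minus subf_diff subf_mult)
  ultimately show "subline q j u v \<subseteq> subline q j ?A ?B"
    by (metis subline_frame_subset)
qed (rule subline_frame_subset[OF coords det])

end

lemma lincomb_3:
  "lincomb [g1, g2, g3] [w1, w2, w3] = vadd (vsmul g1 w1) (vadd (vsmul g2 w2) (vsmul g3 w3))"
  by (simp add: lincomb_def vadd_def vsmul_def numeral_3_eq_3 lessThan_Suc add.assoc)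

lemma vadd_vsmul_lin_3:
  "vadd (vsmul g1 (lin a1 u b1 v)) (vadd (vsmul g2 (lin a2 u b2 v)) (vsmul g3 (lin a3 u b3 v)))
    = lin (g1 * a1 + g2 * a2 + g3 * a3) u (g1 * b1 + g2 * b2 + g3 * b3) v"
  by (simp add: lin_def vadd_def vsmul_def algebra_simps)

definition power_comb :: "'a::comm_semiring_1 \<Rightarrow> 'a list \<Rightarrow> 'a" where
  "power_comb \<eta> cs = (\<Sum>i<length cs. cs ! i * \<eta> ^ i)"

context field_qn
begin

lemma indepQ_3_iff:
  "indepQ q [w1, w2, w3 :: 'a vec3] \<longleftrightarrow>
    (\<forall>g1 g2 g3. g1 \<in> subf q 1 \<longrightarrow> g2 \<in> subf q 1 \<longrightarrow> g3 \<in> subf q 1 \<longrightarrow>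
      vadd (vsmul g1 w1) (vadd (vsmul g2 w2) (vsmul g3 w3)) = (0, 0, 0) \<longrightarrow> g1 = 0 \<and> g2 = 0 \<and> g3 = 0)"
  (is "_ \<longleftrightarrow> ?R")
proof
  assume H: "indepQ q [w1, w2, w3]"
  show ?R
  proof (intro allI impI)
    fix g1 g2 g3 assume "g1 \<in> subf q 1" "g2 \<in> subf q 1" "g3 \<in> subf q 1"
      "vadd (vsmul g1 w1) (vadd (vsmul g2 w2) (vsmul g3 w3)) = (0, 0, 0)"
    hence "set [g1, g2, g3] \<subseteq> {0}"
      using H[unfolded indepQ_def, rule_format, of "[g1, g2, g3]"] by (simp add: lincomb_3)
    thus "g1 = 0 \<and> g2 = 0 \<and> g3 = 0" by simp
  qed
next
  assume R: ?R
  show "indepQ q [w1, w2, w3]" unfolding indepQ_def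
  proof (intro allI impI)
    fix cs :: "'a list"
    assume cs: "length cs = length [w1, w2, w3] \<and> set cs \<subseteq> subf q 1 \<and> lincomb cs [w1, w2, w3] = (0, 0, 0)"
    then obtain g1 g2 g3 where "cs = [g1, g2, g3]"
      by (auto simp: numeral_3_eq_3 length_Suc_conv)
    thus "set cs \<subseteq> {0}" using R cs by (auto simp: lincomb_3)
  qed
qed

lemma subline_three_points_frame:
  assumes ind: "indepN u (v::'a vec3)"
    and P: "P1 \<in> subline q k u v" "P2 \<in> subline q k u v" "P3 \<in> subline q k u v"
    and dist: "P1 \<noteq> P2" "P1 \<noteq> P3" "P2 \<noteq> P3"
  obtains A B where "indepN A B" "subline q k A B = subline q k u v"
    "P1 = ptN A" "P2 = ptN B" "P3 = ptN (lin 1 A 1 B)"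
proof -
  let ?K = "subf q k :: 'a set"
  obtain s1 t1 where 1: "P1 = ptN (lin s1 u t1 v)" "s1 \<in> ?K" "t1 \<in> ?K" "(s1, t1) \<noteq> (0, 0)"
    using P(1) by (rule subline_cases)
  obtain s2 t2 where 2: "P2 = ptN (lin s2 u t2 v)" "s2 \<in> ?K" "t2 \<in> ?K" "(s2, t2) \<noteq> (0, 0)"
    using P(2) by (rule subline_cases)
  obtain s3 t3 where 3: "P3 = ptN (lin s3 u t3 v)" "s3 \<in> ?K" "t3 \<in> ?K" "(s3, t3) \<noteq> (0, 0)"
    using P(3) by (rule subline_cases)
  define \<delta> where "\<delta> = s1 * t2 - s2 * t1"
  have \<delta>: "\<delta> \<noteq> 0"
  proof
    assume "\<delta> = 0"
    hence "P2 = P1" using 1 2 ptN_lin_eq_if_det2_eq_0[of s1 t2 s2 t1] by (simp add: \<delta>_def)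
    thus False using dist(1) by simp
  qed
  define a b where "a = (s3 * t2 - s2 * t3) / \<delta>" and "b = (s1 * t3 - s3 * t1) / \<delta>"
  have ab: "a * s1 + b * s2 = s3" "a * t1 + b * t2 = t3"
    using cramer2[of s1 t2 s2 t1 s3 t3] \<delta> by (simp_all add: a_def b_def \<delta>_def)
  have abK: "a \<in> ?K" "b \<in> ?K"
    using 1 2 3 by (auto simp: a_def b_def \<delta>_def intro!: subf_divide subf_diff subf_mult)
  have P3_ab: "P3 = ptN (lin a (lin s1 u t1 v) b (lin s2 u t2 v))"
    using 3(1) ab by (simp add: lin_lin)
  have "(a, b) \<noteq> (0, 0)" using ab 3(4) by auto
  moreover have "ptN (lin a (lin s1 u t1 v) b (lin s2 u t2 v)) \<noteq> ptN (lin s1 u t1 v)"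
    "ptN (lin a (lin s1 u t1 v) b (lin s2 u t2 v)) \<noteq> ptN (lin s2 u t2 v)"
    using dist(2,3) P3_ab 1(1) 2(1) by simp_all
  ultimately have "a \<noteq> 0" "b \<noteq> 0" using ptN_lin_coeffs_nonzero by blast+
  define A B where "A = lin (a * s1) u (a * t1) v" and "B = lin (b * s2) u (b * t2) v"
  have "a * s1 * (b * t2) - b * s2 * (a * t1) = a * b * \<delta>" by (simp add: \<delta>_def algebra_simps)
  hence det: "a * s1 * (b * t2) - b * s2 * (a * t1) \<noteq> 0" using \<delta> \<open>a \<noteq> 0\<close> \<open>b \<noteq> 0\<close> by simp
  show ?thesis
  proof (rule that)
    show "indepN A B" unfolding A_def B_def by (rule indepN_lin_frame[OF ind det])
    show "subline q k A B = subline q k u v" unfolding A_def B_def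
      using 1 2 abK by (intro subline_frame_eq[OF ind _ _ _ _ det]) (auto intro: subf_mult)
    show "P1 = ptN A" "P2 = ptN B"
      using 1(1) 2(1) \<open>a \<noteq> 0\<close> \<open>b \<noteq> 0\<close> by (simp_all add: A_def B_def ptN_vsmul flip: vsmul_lin)
    show "P3 = ptN (lin 1 A 1 B)" using 3(1) ab by (simp add: A_def B_def lin_lin mult.assoc)
  qed
qed

lemma proj_span_2_coords:
  assumes "ptS q (w::'a vec3) \<in> proj_span q [u, v]"
  obtains a b where "a \<in> subf q 1" "b \<in> subf q 1" "w = lin a u b v"
proof -
  obtain w' where w': "ptS q w = ptS q w'" "w' \<in> spanQ q [u, v]"
    using assms unfolding proj_span_def by auto
  then obtain cs where cs: "w' = lincomb cs [u, v]" "length cs = 2" "set cs \<subseteq> subf q 1"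
    unfolding spanQ_def by auto
  then obtain a b where "cs = [a, b]" by (auto simp: numeral_2_eq_2 length_Suc_conv)
  hence ab: "w' = lincomb [a, b] [u, v]" "a \<in> subf q 1" "b \<in> subf q 1" using cs by auto
  obtain c where c: "c \<in> subf q 1" "w = vsmul c w'" using ptS_eqD[OF w'(1)[symmetric]] by blast
  have "lincomb [a, b] [u, v] = lin a u b v"
    by (simp add: lincomb_def lin_def vadd_def vsmul_def numeral_2_eq_2 lessThan_Suc)
  hence "w = lin (c * a) u (c * b) v" using c ab by (simp add: vsmul_lin)
  moreover have "c * a \<in> subf q 1" "c * b \<in> subf q 1" using c ab by (simp_all add: subf_mult)
  ultimately show ?thesis using that by blast
qed

lemma indepQ_not_collinear3:
  assumes "indepQ q [w1, w2, w3 :: 'a vec3]"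
  shows "\<not> collinear3 q (ptS q w1) (ptS q w2) (ptS q w3)"
proof
  have dep: "g1 = 0 \<and> g2 = 0 \<and> g3 = 0"
    if "g1 \<in> subf q 1" "g2 \<in> subf q 1" "g3 \<in> subf q 1"
      "vadd (vsmul g1 w1) (vadd (vsmul g2 w2) (vsmul g3 w3)) = (0, 0, 0)" for g1 g2 g3
    using assms that by (simp add: indepQ_3_iff)
  assume "collinear3 q (ptS q w1) (ptS q w2) (ptS q w3)"
  then obtain u v where uv: "{ptS q w1, ptS q w2, ptS q w3} \<subseteq> proj_span q [u, v]"
    unfolding collinear3_def by blast
  obtain a1 b1 where 1: "a1 \<in> subf q 1" "b1 \<in> subf q 1" "w1 = lin a1 u b1 v"
    using uv proj_span_2_coords[of w1 u v] by auto
  obtain a2 b2 where 2: "a2 \<in> subf q 1" "b2 \<in> subf q 1" "w2 = lin a2 u b2 v"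
    using uv proj_span_2_coords[of w2 u v] by auto
  obtain a3 b3 where 3: "a3 \<in> subf q 1" "b3 \<in> subf q 1" "w3 = lin a3 u b3 v"
    using uv proj_span_2_coords[of w3 u v] by auto
  note coords = 1 2 3
  have "(a1, b1) \<noteq> (0, 0)"
  proof
    assume "(a1, b1) = (0, 0)"
    hence "vadd (vsmul 1 w1) (vadd (vsmul 0 w2) (vsmul 0 w3)) = (0, 0, 0)"
      using coords(3) by (simp add: vadd_def vsmul_def)
    thus False using dep[of 1 0 0] by simp
  qed
  text \<open>The 2 \<times> 2 minors of the coordinate matrix give a linear relation among w1, w2, w3.\<close>
  have "vadd (vsmul (a2 * b3 - a3 * b2) w1) (vadd (vsmul (a3 * b1 - a1 * b3) w2)
      (vsmul (a1 * b2 - a2 * b1) w3)) = (0, 0, 0)"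
    unfolding coords(3,6,9) vadd_vsmul_lin_3 by (simp add: algebra_simps lin_def vadd_def)
  hence "a1 * b2 - a2 * b1 = 0"
    using dep[of "a2 * b3 - a3 * b2" "a3 * b1 - a1 * b3" "a1 * b2 - a2 * b1"] coords
    by (simp add: subf_diff subf_mult)
  define c where "c = (if a1 = 0 then b2 / b1 else a2 / a1)"
  have "c \<in> subf q 1" unfolding c_def using coords by (auto intro: subf_divide)
  moreover have "a2 = c * a1" "b2 = c * b1"
    using det2_eq_0_proportional[of a1 b2 a2 b1] \<open>a1 * b2 - a2 * b1 = 0\<close> \<open>(a1, b1) \<noteq> (0, 0)\<close>
    by (simp_all add: c_def)
  ultimately have c: "c \<in> subf q 1" "a2 = c * a1" "b2 = c * b1" by blast+
  hence "w2 = vsmul c w1" using coords(3,6) by (simp add: vsmul_lin)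
  hence "vadd (vsmul c w1) (vadd (vsmul (- 1) w2) (vsmul 0 w3)) = (0, 0, 0)"
    by (simp add: vadd_def vsmul_def)
  thus False using dep[of c "- 1" 0] c(1) subf_minus[of 1] by simp
qed

subsection \<open>A power basis of F_{q^r}\<close>

lemma sum_powers_less: "(\<Sum>j<r. q ^ j) < q ^ r"
proof (induction r)
  case (Suc r)
  have "(\<Sum>j<Suc r. q ^ j) < q ^ r + q ^ r" using Suc by simp
  also have "\<dots> \<le> q * q ^ r" using q_ge_2 by (simp add: mult_2[symmetric])
  finally show ?case by simp
qed simp

lemma ex_subf_generator:
  assumes r: "r dvd n"
  obtains \<eta> where "\<eta> \<in> subf q r" "\<forall>j. 1 \<le> j \<longrightarrow> j < r \<longrightarrow> (\<eta>::'a) ^ (q ^ j) \<noteq> \<eta>"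
proof -
  let ?smaller = "\<Union>j\<in>{1..<r}. (subf q j :: 'a set)"
  have "card ?smaller \<le> (\<Sum>j\<in>{1..<r}. card (subf q j :: 'a set))" by (rule card_UN_le) simp
  also have "\<dots> \<le> (\<Sum>j\<in>{1..<r}. q ^ j)" by (intro sum_mono card_subf_le) auto
  also have "\<dots> \<le> (\<Sum>j<r. q ^ j)" by (intro sum_mono2) auto
  also have "\<dots> < card (subf q r :: 'a set)" using sum_powers_less card_subf[OF r] by simp
  finally have "\<not> subf q r \<subseteq> ?smaller" using card_mono[of ?smaller "subf q r"] by auto
  then obtain \<eta> where "\<eta> \<in> subf q r" "\<eta> \<notin> ?smaller" by blast
  thus ?thesis using that by (auto simp: subf_iff)
qed

text \<open>A vanishing combination gives a nonzero polynomial of degree < r over F_q that vanishes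
  at the r distinct conjugates \<eta>^(q^j).\<close>
lemma power_comb_eq_0_imp:
  assumes \<eta>: "\<forall>j. 1 \<le> j \<longrightarrow> j < r \<longrightarrow> (\<eta>::'a) ^ (q ^ j) \<noteq> \<eta>"
    and cs: "length cs = r" "set cs \<subseteq> subf q 1" "power_comb \<eta> cs = 0"
  shows "set cs \<subseteq> {0}"
proof (rule ccontr)
  assume nz: "\<not> set cs \<subseteq> {0}"
  define g :: "'a poly" where "g = (\<Sum>i<r. monom (cs ! i) i)"
  have "coeff g i = (if i < r then cs ! i else 0)" for i
    by (simp add: g_def coeff_sum coeff_monom)
  moreover obtain i where "i < r" "cs ! i \<noteq> 0"
  proof -
    obtain x where "x \<in> set cs" "x \<noteq> 0" using nz by auto
    thus ?thesis using that cs(1) by (auto simp: in_set_conv_nth)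
  qed
  ultimately have "coeff g i \<noteq> 0" by simp
  hence "g \<noteq> 0" by auto
  have "r \<ge> 1" using nz cs(1) by (cases r) auto
  have "degree g \<le> r - 1" unfolding g_def
    by (rule degree_sum_le) (auto intro: order.trans[OF degree_monom_le])
  hence "degree g < r" using \<open>r \<ge> 1\<close> by simp
  have roots: "poly g (\<eta> ^ (q ^ j)) = 0" for j
  proof -
    have "cs ! i * (\<eta> ^ (q ^ j)) ^ i = (cs ! i * \<eta> ^ i) ^ (q ^ j)" if "i < r" for i
    proof -
      have "cs ! i \<in> subf q 1" using cs(1,2) that nth_mem by blast
      hence "cs ! i \<in> subf q j" by (rule subf_1_subf)
      thus ?thesis by (simp add: power_mult_distrib subf_iff flip: power_mult) (simp add: mult.commute)
    qed
    hence "poly g (\<eta> ^ (q ^ j)) = (\<Sum>i<r. (cs ! i * \<eta> ^ i) ^ (q ^ j))"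
      by (simp add: g_def poly_sum poly_monom)
    also have "\<dots> = (power_comb \<eta> cs) ^ (q ^ j)" unfolding power_comb_def cs(1) by (rule frob_sum[symmetric])
    finally show ?thesis using cs(3) q_pos by simp
  qed
  have "inj_on (\<lambda>j. \<eta> ^ (q ^ j)) {..<r}" using conjugates_inj[OF \<eta>] by (auto intro: inj_onI)
  hence "r = card ((\<lambda>j. \<eta> ^ (q ^ j)) ` {..<r})" by (simp add: card_image)
  also have "\<dots> \<le> card {x. poly g x = 0}"
    using roots poly_roots_finite[OF \<open>g \<noteq> 0\<close>] by (intro card_mono) auto
  also have "\<dots> \<le> degree g" by (rule card_poly_roots_bound[OF \<open>g \<noteq> 0\<close>])
  finally show False using \<open>degree g < r\<close> by simp
qed

lemma power_comb_image:
  assumes r: "r dvd n" and \<eta>: "\<eta> \<in> subf q r" "\<forall>j. 1 \<le> j \<longrightarrow> j < r \<longrightarrow> (\<eta>::'a) ^ (q ^ j) \<noteq> \<eta>"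
  shows "power_comb \<eta> ` {cs. set cs \<subseteq> subf q 1 \<and> length cs = r} = subf q r"
proof (rule card_subset_eq)
  let ?C = "{cs. set cs \<subseteq> (subf q 1 :: 'a set) \<and> length cs = r}"
  have "cs ! i \<in> subf q r" if "cs \<in> ?C" "i < length cs" for cs i
    using that nth_mem subf_1_subf by blast
  thus "power_comb \<eta> ` ?C \<subseteq> subf q r"
    using \<eta>(1) by (auto simp: power_comb_def intro!: subf_sum subf_mult subf_power)
  have "inj_on (power_comb \<eta>) ?C"
  proof (rule inj_onI)
    fix xs ys assume xs: "xs \<in> ?C" and ys: "ys \<in> ?C" and eq: "power_comb \<eta> xs = power_comb \<eta> ys"
    define d where "d = map (\<lambda>i. xs ! i - ys ! i) [0..<r]"
    have "power_comb \<eta> d = power_comb \<eta> xs - power_comb \<eta> ys"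
      using xs ys by (simp add: d_def power_comb_def left_diff_distrib sum_subtractf)
    moreover have "set d \<subseteq> subf q 1" using xs ys by (auto simp: d_def intro!: subf_diff)
    moreover have "length d = r" by (simp add: d_def)
    ultimately have "set d \<subseteq> {0}" using power_comb_eq_0_imp[OF \<eta>(2)] eq by simp
    hence "xs ! i = ys ! i" if "i < r" for i using that by (auto simp: d_def image_subset_iff)
    thus "xs = ys" using xs ys by (intro nth_equalityI) auto
  qed
  hence "card (power_comb \<eta> ` ?C) = card (subf q 1 :: 'a set) ^ r"
    using card_lists_length_eq[of "subf q 1 :: 'a set" r] by (simp add: card_image conj_commute)
  thus "card (power_comb \<eta> ` ?C) = card (subf q r :: 'a set)" using card_subf[of 1] card_subf[OF r] by simp
qed simp

end

section \<open>Normal rational curves\<close>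

definition monomials :: "nat \<Rightarrow> 'a::comm_semiring_1 \<Rightarrow> 'a \<Rightarrow> 'a list" where
  "monomials d s t = map (\<lambda>i. s ^ (d - i) * t ^ i) [0..<d + 1]"

lemma length_monomials [simp]: "length (monomials d s t) = Suc d"
  by (simp add: monomials_def)

lemma nth_monomials [simp]: "i < Suc d \<Longrightarrow> monomials d s t ! i = s ^ (d - i) * t ^ i"
  by (simp add: monomials_def del: upt_Suc)

lemma nrc_eq_monomials:
  "nrc q d es = {ptS q (lincomb (monomials d s t) es) | s t.
      s \<in> subf q 1 \<and> t \<in> subf q 1 \<and> (s, t) \<noteq> (0, 0)}"
  by (simp add: nrc_def monomials_def)

context field_qn
begin

lemma poly_map_poly_frob:
  "poly (map_poly (\<lambda>x::'a. x ^ q) f) (y ^ q) = (poly f y) ^ q"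
proof -
  have "(y ^ q) ^ i = (y ^ i) ^ q" for i by (simp flip: power_mult add: mult.commute)
  hence "poly (map_poly (\<lambda>x. x ^ q) f) (y ^ q) = (\<Sum>i\<le>degree f. (coeff f i * y ^ i) ^ q)"
    using q_pos by (simp add: poly_altdef degree_map_poly coeff_map_poly power_mult_distrib)
  also have "\<dots> = (\<Sum>i\<le>degree f. coeff f i * y ^ i) ^ q"
    using frob_sum[of "\<lambda>i. coeff f i * y ^ i" "{..degree f}" 1] by simp
  finally show ?thesis by (simp add: poly_altdef)
qed

lemma less_card_if_le_n: "d \<le> n \<Longrightarrow> d < q ^ n"
  using less_exp[of n] power_mono[OF q_ge_2, of n] by linarith

lemma map_poly_frob_eqI:
  fixes f g :: "'a poly"
  assumes "\<And>x. (poly f x) ^ q = poly g (x ^ q)" "degree f \<le> n" "degree g \<le> n"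
  shows "map_poly (\<lambda>x. x ^ q) f = g"
proof (rule poly_eqI_degree[of UNIV])
  fix y :: 'a
  obtain x where "x ^ (q ^ 1) = y" using frob_surj by blast
  thus "poly (map_poly (\<lambda>x. x ^ q) f) y = poly g y"
    using poly_map_poly_frob[of f x] assms(1)[of x] by simp
  show "degree (map_poly (\<lambda>x. x ^ q) f) < card (UNIV :: 'a set)"
    using assms(2) q_pos by (simp add: degree_map_poly card_UNIV less_card_if_le_n)
  show "degree g < card (UNIV :: 'a set)"
    using assms(3) by (simp add: card_UNIV less_card_if_le_n)
qed

end

text \<open>norm_poly is the minimal polynomial of -\<mu> over F_q, and cofactor l omits its l-th
  linear factor.\<close>
locale nrc_setup = field_qn q n p e field_type
  for q n p e :: nat and field_type :: "'a::{field,finite} itself" +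
  fixes \<mu> :: 'a
  assumes mu_notin: "\<mu> \<notin> subf q 1"
begin

definition deg_mu :: nat where "deg_mu = (LEAST j. j \<ge> 1 \<and> \<mu> ^ (q ^ j) = \<mu>)"
definition mu_conj :: "nat \<Rightarrow> 'a" where "mu_conj i = \<mu> ^ (q ^ i)"
definition factor :: "nat \<Rightarrow> 'a poly" where "factor i = [:mu_conj i, 1:]"
definition norm_poly :: "'a poly" where "norm_poly = (\<Prod>i<deg_mu. factor i)"
definition cofactor :: "nat \<Rightarrow> 'a poly" where "cofactor l = (\<Prod>i\<in>{..<deg_mu}-{l}. factor i)"

lemma deg_mu: "deg_mu \<ge> 1" "\<mu> ^ (q ^ deg_mu) = \<mu>"
  using LeastI_ex[of "\<lambda>j. j \<ge> 1 \<and> \<mu> ^ (q ^ j) = \<mu>"] n_pos frob_n unfolding deg_mu_def by blast+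

lemma deg_mu_le_n: "deg_mu \<le> n"
  unfolding deg_mu_def using n_pos frob_n by (intro Least_le) simp

lemma deg_mu_minimal: "\<forall>j. 1 \<le> j \<longrightarrow> j < deg_mu \<longrightarrow> \<mu> ^ (q ^ j) \<noteq> \<mu>"
  unfolding deg_mu_def using not_less_Least by blast

lemma deg_mu_ge_2: "deg_mu \<ge> 2"
  using deg_mu mu_notin by (cases "deg_mu = 1") (auto simp: subf_iff)

lemma mu_conj_Suc: "(mu_conj i) ^ q = mu_conj (Suc i)"
  using frob_frob[of \<mu> i 1] by (simp add: mu_conj_def)

lemma mu_conj_inj: "i < deg_mu \<Longrightarrow> j < deg_mu \<Longrightarrow> mu_conj i = mu_conj j \<Longrightarrow> i = j"
  using conjugates_inj[OF deg_mu_minimal] by (simp add: mu_conj_def)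

lemma poly_norm_poly: "poly norm_poly x = (\<Prod>i<deg_mu. mu_conj i + x)"
  by (simp add: norm_poly_def factor_def poly_prod)

lemma poly_cofactor: "poly (cofactor l) x = (\<Prod>i\<in>{..<deg_mu}-{l}. mu_conj i + x)"
  by (simp add: cofactor_def factor_def poly_prod)

lemma degree_norm_poly: "degree norm_poly = deg_mu"
  unfolding norm_poly_def by (subst degree_prod_eq_sum_degree) (auto simp: factor_def)

lemma coeff_norm_poly_deg_mu: "coeff norm_poly deg_mu = 1"
  using lead_coeff_prod[of factor "{..<deg_mu}"] degree_norm_poly
  by (simp add: norm_poly_def factor_def)

lemma degree_cofactor: "l < deg_mu \<Longrightarrow> degree (cofactor l) = deg_mu - 1"
  unfolding cofactor_def by (subst degree_prod_eq_sum_degree) (auto simp: factor_def)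

lemma norm_poly_eq: "norm_poly = [:\<mu>, 1:] * cofactor 0"
proof -
  have "0 \<in> {..<deg_mu}" using deg_mu(1) by simp
  hence "norm_poly = factor 0 * cofactor 0" by (simp add: norm_poly_def cofactor_def prod.remove)
  thus ?thesis by (simp add: factor_def mu_conj_def)
qed

lemma map_poly_frob_norm_poly: "map_poly (\<lambda>x. x ^ q) norm_poly = norm_poly"
proof (rule map_poly_frob_eqI)
  fix x :: 'a
  have "(poly norm_poly x) ^ q = (\<Prod>i<deg_mu. mu_conj (Suc i) + x ^ q)"
    using frob_add[of _ _ 1] by (simp add: poly_norm_poly prod_power_distrib mu_conj_Suc)
  also have "\<dots> = poly norm_poly (x ^ q)"
    unfolding poly_norm_poly by (rule prod_lessThan_cyclic_shift) (simp add: mu_conj_def deg_mu)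
  finally show "(poly norm_poly x) ^ q = poly norm_poly (x ^ q)" .
qed (use degree_norm_poly deg_mu_le_n in auto)

lemma coeff_norm_poly_subf: "coeff norm_poly i \<in> subf q 1"
  using arg_cong[OF map_poly_frob_norm_poly, of "\<lambda>f. coeff f i"] q_pos
  by (simp add: coeff_map_poly subf_iff)

lemma map_poly_frob_cofactor:
  assumes "Suc l < deg_mu" shows "map_poly (\<lambda>x. x ^ q) (cofactor l) = cofactor (Suc l)"
proof (rule map_poly_frob_eqI)
  fix x :: 'a
  let ?g = "\<lambda>i. mu_conj i + x ^ q"
  have "(poly (cofactor l) x) ^ q = (\<Prod>i\<in>{..<deg_mu}-{l}. ?g (Suc i))"
    using frob_add[of _ _ 1] by (simp add: poly_cofactor prod_power_distrib mu_conj_Suc)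
  also have "\<dots> = (\<Prod>i\<in>Suc ` ({..<deg_mu}-{l}). ?g i)" by (subst prod.reindex) auto
  also have "Suc ` ({..<deg_mu}-{l}) = insert deg_mu ({1..<deg_mu} - {Suc l})"
  proof (rule Set.set_eqI)
    fix x show "x \<in> Suc ` ({..<deg_mu}-{l}) \<longleftrightarrow> x \<in> insert deg_mu ({1..<deg_mu} - {Suc l})"
      using assms by (cases x) auto
  qed
  also have "(\<Prod>i\<in>insert deg_mu ({1..<deg_mu} - {Suc l}). ?g i) = ?g deg_mu * (\<Prod>i\<in>{1..<deg_mu} - {Suc l}. ?g i)"
    by (rule prod.insert) auto
  also have "?g deg_mu = ?g 0" by (simp add: mu_conj_def deg_mu)
  also have "?g 0 * (\<Prod>i\<in>{1..<deg_mu} - {Suc l}. ?g i) = (\<Prod>i\<in>insert 0 ({1..<deg_mu} - {Suc l}). ?g i)"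
    by (rule prod.insert[symmetric]) auto
  also have "insert 0 ({1..<deg_mu} - {Suc l}) = {..<deg_mu} - {Suc l}" using deg_mu by auto
  finally show "(poly (cofactor l) x) ^ q = poly (cofactor (Suc l)) (x ^ q)" by (simp add: poly_cofactor)
qed (use degree_cofactor assms deg_mu_le_n in auto)

definition coeff_form :: "(nat \<Rightarrow> 'a) \<Rightarrow> 'a poly \<Rightarrow> 'a" where
  "coeff_form c f = (\<Sum>i<Suc deg_mu. c i * coeff f i)"

lemma coeff_form_frob:
  assumes "\<forall>i. c i \<in> subf q 1"
  shows "coeff_form c (map_poly (\<lambda>x. x ^ q) f) = (coeff_form c f) ^ q"
proof -
  have "(coeff_form c f) ^ q = (\<Sum>i<Suc deg_mu. (c i * coeff f i) ^ q)"
    unfolding coeff_form_def using frob_sum[of "\<lambda>i. c i * coeff f i" "{..<Suc deg_mu}" 1] by simp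
  also have "\<dots> = (\<Sum>i<Suc deg_mu. c i * (coeff f i) ^ q)"
    using assms by (simp add: power_mult_distrib subf_iff)
  finally show ?thesis using q_pos by (simp add: coeff_form_def coeff_map_poly)
qed

lemma coeff_form_sum:
  "coeff_form c (\<Sum>l\<in>A. smult (a l) (f l)) = (\<Sum>l\<in>A. a l * coeff_form c (f l))"
  unfolding coeff_form_def
  by (simp add: coeff_sum sum_distrib_left mult_ac sum.swap[of _ A] del: sum.lessThan_Suc)

lemma coeff_form_monom: "i < Suc deg_mu \<Longrightarrow> coeff_form c (monom 1 i) = c i"
  unfolding coeff_form_def by (simp add: coeff_monom if_distrib[of "(*) _"] cong: if_cong del: sum.lessThan_Suc)

text \<open>Lagrange interpolation at the deg_mu distinct points -\<mu>^(q^l).\<close>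
lemma monom_eq_cofactor_sum:
  assumes i: "i < deg_mu"
  shows "monom 1 i = (\<Sum>l<deg_mu. smult ((- mu_conj l) ^ i / poly (cofactor l) (- mu_conj l)) (cofactor l))"
    (is "_ = ?R")
proof (rule poly_eqI_degree[of "(\<lambda>l. - mu_conj l) ` {..<deg_mu}"])
  have "card ((\<lambda>l. - mu_conj l) ` {..<deg_mu}) = deg_mu"
    using mu_conj_inj by (subst card_image) (auto intro!: inj_onI)
  moreover have "degree ?R \<le> deg_mu - 1"
    by (rule degree_sum_le) (auto intro: order.trans[OF degree_smult_le] simp: degree_cofactor)
  ultimately show "degree (monom (1::'a) i) < card ((\<lambda>l. - mu_conj l) ` {..<deg_mu})"
    "degree ?R < card ((\<lambda>l. - mu_conj l) ` {..<deg_mu})"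
    using i deg_mu by (simp_all add: degree_monom_eq)
  fix x assume "x \<in> (\<lambda>l. - mu_conj l) ` {..<deg_mu}"
  then obtain l0 where l0: "l0 < deg_mu" "x = - mu_conj l0" by auto
  have "poly (cofactor l) x = 0" if "l < deg_mu" "l \<noteq> l0" for l
    unfolding poly_cofactor l0(2) using that l0 by (intro prod_zero) auto
  hence "poly ?R x = (- mu_conj l0) ^ i / poly (cofactor l0) (- mu_conj l0) * poly (cofactor l0) x"
    using l0 by (simp add: poly_sum sum.remove[of _ l0])
  also have "\<dots> = x ^ i"
  proof -
    have "poly (cofactor l0) x \<noteq> 0" unfolding poly_cofactor l0(2) using mu_conj_inj l0 by auto
    thus ?thesis using l0 by simp
  qed
  finally show "poly (monom 1 i) x = poly ?R x" by (simp add: poly_monom)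
qed

lemma coeff_form_eq_0_imp:
  assumes c: "\<forall>i. c i \<in> subf q 1"
    and norm: "coeff_form c norm_poly = 0" and cof: "coeff_form c (cofactor 0) = 0"
    and i: "i \<le> deg_mu"
  shows "c i = 0"
proof -
  have cof_l: "coeff_form c (cofactor l) = 0" if "l < deg_mu" for l
    using that
  proof (induction l)
    case (Suc l)
    thus ?case using map_poly_frob_cofactor[of l, symmetric] coeff_form_frob[OF c] q_pos by simp
  qed (rule cof)
  have low: "c i = 0" if "i < deg_mu" for i
  proof -
    have "c i = coeff_form c (monom 1 i)" using that by (simp add: coeff_form_monom)
    also have "\<dots> = (\<Sum>l<deg_mu. ((- mu_conj l) ^ i / poly (cofactor l) (- mu_conj l)) * coeff_form c (cofactor l))"
      by (subst monom_eq_cofactor_sum[OF that]) (rule coeff_form_sum)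
    also have "\<dots> = 0" using cof_l by simp
    finally show ?thesis .
  qed
  hence "c deg_mu = 0" using norm coeff_norm_poly_deg_mu by (simp add: coeff_form_def)
  thus "c i = 0" using low i by (cases "i = deg_mu") auto
qed

end

lemma lincomb_add3:
  assumes "length xs = length ws" "length ys = length ws" "length zs = length ws"
  shows "lincomb (map (\<lambda>i. a * xs ! i + b * ys ! i + c * zs ! i) [0..<length ws]) ws =
    vadd (vsmul a (lincomb xs ws)) (vadd (vsmul b (lincomb ys ws)) (vsmul c (lincomb zs ws)))"
  using assms unfolding lincomb_def vadd_def vsmul_def
  by (simp add: sum.distrib sum_distrib_left algebra_simps)

text \<open>As A = D + \<mu>B, we have sA + tB = (s\<mu> + t)B + sD. Scaling by cofactor_form s t, the
  homogenised cofactor, turns the two coefficients into the homogenised norm_poly and cofactor 0,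
  whose coefficients define nrc_vec.\<close>
locale nrc_frame = nrc_setup q n p e field_type \<mu>
  for q n p e :: nat and field_type :: "'a::{field,finite} itself" and \<mu> :: 'a +
  fixes a1 a2 b1 b2 :: 'a
  assumes indepN_A_B: "indepN (a1, a2, \<mu>) (b1, b2, 1)"
begin

abbreviation "A \<equiv> (a1, a2, \<mu>)"
abbreviation "B \<equiv> (b1, b2, 1::'a)"

definition D :: "'a vec3" where "D = (a1 - \<mu> * b1, a2 - \<mu> * b2, 0)"
definition nrc_vec :: "nat \<Rightarrow> 'a vec3" where
  "nrc_vec i = lin (coeff norm_poly i) B (coeff (cofactor 0) i) D"
definition nrc_basis :: "'a vec3 list" where "nrc_basis = map nrc_vec [0..<Suc deg_mu]"
definition cofactor_form :: "'a \<Rightarrow> 'a \<Rightarrow> 'a" where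
  "cofactor_form s t = (\<Sum>i<deg_mu. s ^ (deg_mu - 1 - i) * t ^ i * coeff (cofactor 0) i)"

lemma length_nrc_basis [simp]: "length nrc_basis = Suc deg_mu" by (simp add: nrc_basis_def)

lemma lincomb_nrc_basis:
  assumes "length cs = Suc deg_mu"
  shows "lincomb cs nrc_basis =
    lin (\<Sum>i<Suc deg_mu. cs ! i * coeff norm_poly i) B (\<Sum>i<Suc deg_mu. cs ! i * coeff (cofactor 0) i) D"
proof -
  have "nrc_basis ! i = nrc_vec i" if "i < Suc deg_mu" for i
    using that by (simp add: nrc_basis_def del: upt_Suc)
  thus ?thesis
    unfolding lincomb_def length_nrc_basis
    by (simp add: nrc_vec_def lin_def vsmul_def vadd_def D_def sum.distrib sum_distrib_left sum_subtractf
        algebra_simps del: sum.lessThan_Suc)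
qed

lemma lin_B_D_eq_0: "lin x B y D = (0, 0, 0) \<Longrightarrow> x = 0 \<and> y = 0"
proof -
  have "D \<noteq> (0, 0, 0)"
  proof
    assume "D = (0, 0, 0)"
    hence "lin 1 A (- \<mu>) B = (0, 0, 0)" by (simp add: D_def lin_def vsmul_def vadd_def)
    thus False using indepN_lin_eq_0[OF indepN_A_B] by fastforce
  qed
  thus "lin x B y D = (0, 0, 0) \<Longrightarrow> x = 0 \<and> y = 0"
    by (auto simp: lin_def vsmul_def vadd_def D_def)
qed

lemma indepQ_nrc_basis: "indepQ q nrc_basis"
  unfolding indepQ_def
proof (intro allI impI)
  fix cs :: "'a list"
  assume cs: "length cs = length nrc_basis \<and> set cs \<subseteq> subf q 1 \<and> lincomb cs nrc_basis = (0, 0, 0)"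
  hence len: "length cs = Suc deg_mu" by simp
  define c where "c i = (if i < length cs then cs ! i else 0)" for i
  have c: "\<forall>i. c i \<in> subf q 1" using cs by (auto simp: c_def)
  have "coeff_form c f = (\<Sum>i<Suc deg_mu. cs ! i * coeff f i)" for f
    unfolding coeff_form_def c_def len by (intro sum.cong) auto
  hence "lin (coeff_form c norm_poly) B (coeff_form c (cofactor 0)) D = (0, 0, 0)"
    using cs lincomb_nrc_basis[OF len] by simp
  hence "coeff_form c norm_poly = 0 \<and> coeff_form c (cofactor 0) = 0" by (rule lin_B_D_eq_0)
  hence "c i = 0" if "i < Suc deg_mu" for i using coeff_form_eq_0_imp[OF c] that by simp
  thus "set cs \<subseteq> {0}" using len by (auto simp: c_def in_set_conv_nth)
qed

lemma inV_nrc_basis: "\<forall>x\<in>set nrc_basis. inV q x"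
  using coeff_norm_poly_subf
  by (auto simp: nrc_basis_def nrc_vec_def inV_def lin_def vsmul_def vadd_def D_def simp del: upt_Suc)

lemma monomial_sum_cofactor:
  "(\<Sum>i<Suc deg_mu. s ^ (deg_mu - i) * t ^ i * coeff (cofactor 0) i) = s * cofactor_form s t"
proof -
  have "coeff (cofactor 0) deg_mu = 0" using degree_cofactor[of 0] deg_mu by (intro coeff_eq_0) auto
  moreover have "s ^ (deg_mu - i) = s * s ^ (deg_mu - 1 - i)" if "i < deg_mu" for i
    using that by (simp flip: power_Suc add: Suc_diff_Suc)
  ultimately show ?thesis by (simp add: cofactor_form_def sum_distrib_left mult.assoc)
qed

lemma monomial_sum_norm_poly:
  "(\<Sum>i<Suc deg_mu. s ^ (deg_mu - i) * t ^ i * coeff norm_poly i) = (s * \<mu> + t) * cofactor_form s t"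
proof -
  have "coeff norm_poly i = \<mu> * coeff (cofactor 0) i + (case i of 0 \<Rightarrow> 0 | Suc j \<Rightarrow> coeff (cofactor 0) j)" for i
    by (cases i) (simp_all add: norm_poly_eq)
  hence "(\<Sum>i<Suc deg_mu. s ^ (deg_mu - i) * t ^ i * coeff norm_poly i) =
      \<mu> * (\<Sum>i<Suc deg_mu. s ^ (deg_mu - i) * t ^ i * coeff (cofactor 0) i) +
      (\<Sum>i<Suc deg_mu. s ^ (deg_mu - i) * t ^ i * (case i of 0 \<Rightarrow> 0 | Suc j \<Rightarrow> coeff (cofactor 0) j))"
    by (simp add: algebra_simps sum.distrib sum_distrib_left del: sum.lessThan_Suc)
  also have "(\<Sum>i<Suc deg_mu. s ^ (deg_mu - i) * t ^ i * (case i of 0 \<Rightarrow> 0 | Suc j \<Rightarrow> coeff (cofactor 0) j))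
      = t * cofactor_form s t"
    by (subst sum.lessThan_Suc_shift) (simp add: cofactor_form_def sum_distrib_left algebra_simps)
  also have "\<mu> * (\<Sum>i<Suc deg_mu. s ^ (deg_mu - i) * t ^ i * coeff (cofactor 0) i) = \<mu> * (s * cofactor_form s t)"
    by (simp only: monomial_sum_cofactor)
  finally show ?thesis by (simp add: algebra_simps)
qed

lemma lincomb_monomials:
  "lincomb (monomials deg_mu s t) nrc_basis = vsmul (cofactor_form s t) (lin s A t B)"
proof -
  have "lincomb (monomials deg_mu s t) nrc_basis = lin ((s * \<mu> + t) * cofactor_form s t) B (s * cofactor_form s t) D"
    using lincomb_nrc_basis[of "monomials deg_mu s t"]
    by (simp add: monomial_sum_norm_poly monomial_sum_cofactor del: sum.lessThan_Suc)
  thus ?thesis by (simp add: lin_def vsmul_def vadd_def D_def algebra_simps)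
qed

lemma ptS_nrc_point:
  assumes st: "s \<in> subf q 1" "t \<in> subf q 1" "(s, t) \<noteq> (0, 0)"
  shows "ptS q (lincomb (monomials deg_mu s t) nrc_basis) = phi q (ptN (lin s A t B))"
proof -
  define z where "z = s * \<mu> + t"
  have z: "z \<noteq> 0"
  proof
    assume z0: "z = 0"
    have "s \<noteq> 0" using z0 st(3) by (auto simp: z_def)
    moreover have "s * \<mu> = - t" using z0 by (simp add: z_def eq_neg_iff_add_eq_0)
    ultimately have "\<mu> = - t / s" by (simp add: field_simps)
    thus False using st mu_notin by (simp add: subf_divide subf_minus)
  qed
  define x where "x = vsmul (1 / z) (lin s A t B)"
  have "snd (snd (lin s A t B)) = z" by (simp add: third_lin z_def)
  hence x: "snd (snd x) = 1" "ptN (lin s A t B) = ptN x"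
    using z ptN_vsmul[of "1 / z" "lin s A t B"] by (simp_all add: x_def vsmul_def)
  define N where "N = (\<Sum>i<Suc deg_mu. s ^ (deg_mu - i) * t ^ i * coeff norm_poly i)"
  have N: "N \<in> subf q 1" unfolding N_def
    using st coeff_norm_poly_subf by (intro subf_sum subf_mult subf_power) auto
  have "N = z * cofactor_form s t" unfolding N_def z_def by (rule monomial_sum_norm_poly)
  hence lc: "lincomb (monomials deg_mu s t) nrc_basis = vsmul N x"
    using z by (simp add: lincomb_monomials x_def)
  have "N \<noteq> 0"
  proof
    assume "N = 0"
    hence "lincomb (monomials deg_mu s t) nrc_basis = (0, 0, 0)" using lc by simp
    moreover have "set (monomials deg_mu s t) \<subseteq> subf q 1"
      using st by (auto simp: monomials_def intro!: subf_mult subf_power simp del: upt_Suc)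
    ultimately have "set (monomials deg_mu s t) \<subseteq> {0}"
      using indepQ_nrc_basis unfolding indepQ_def by simp
    moreover have "monomials deg_mu s t ! 0 \<in> set (monomials deg_mu s t)"
      "monomials deg_mu s t ! deg_mu \<in> set (monomials deg_mu s t)"
      by (simp_all del: nth_monomials)
    ultimately have "s ^ deg_mu = 0" "t ^ deg_mu = 0" by auto
    thus False using st by simp
  qed
  thus ?thesis using lc x ptS_vsmul[OF N] phi_ptN_affine[OF x(1)] by simp
qed

lemma nrc_eq_phi_image: "nrc q deg_mu nrc_basis = phi q ` subline q 1 A B"
proof -
  have "phi q ` subline q 1 A B =
      {phi q (ptN (lin s A t B)) | s t. s \<in> subf q 1 \<and> t \<in> subf q 1 \<and> (s, t) \<noteq> (0, 0)}"
    unfolding subline_def lin_def by blast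
  also have "\<dots> = {ptS q (lincomb (monomials deg_mu s t) nrc_basis) | s t.
      s \<in> subf q 1 \<and> t \<in> subf q 1 \<and> (s, t) \<noteq> (0, 0)}"
  proof (intro Collect_cong iffI)
    fix x assume "\<exists>s t. x = phi q (ptN (lin s A t B)) \<and> s \<in> subf q 1 \<and> t \<in> subf q 1 \<and> (s, t) \<noteq> (0, 0)"
    then obtain s t where st: "x = phi q (ptN (lin s A t B))" "s \<in> subf q 1" "t \<in> subf q 1" "(s, t) \<noteq> (0, 0)"
      by blast
    thus "\<exists>s t. x = ptS q (lincomb (monomials deg_mu s t) nrc_basis) \<and> s \<in> subf q 1 \<and> t \<in> subf q 1 \<and> (s, t) \<noteq> (0, 0)"
      using ptS_nrc_point[OF st(2-4)] by blast
  next
    fix x assume "\<exists>s t. x = ptS q (lincomb (monomials deg_mu s t) nrc_basis) \<and> s \<in> subf q 1 \<and> t \<in> subf q 1 \<and> (s, t) \<noteq> (0, 0)"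
    then obtain s t where st: "x = ptS q (lincomb (monomials deg_mu s t) nrc_basis)" "s \<in> subf q 1" "t \<in> subf q 1" "(s, t) \<noteq> (0, 0)"
      by blast
    thus "\<exists>s t. x = phi q (ptN (lin s A t B)) \<and> s \<in> subf q 1 \<and> t \<in> subf q 1 \<and> (s, t) \<noteq> (0, 0)"
      using ptS_nrc_point[OF st(2-4)] by blast
  qed
  finally show ?thesis by (simp add: nrc_eq_monomials)
qed

lemma indepQ_nrc_frame_points:
  "indepQ q [lincomb (monomials deg_mu 1 0) nrc_basis, lincomb (monomials deg_mu 0 1) nrc_basis,
    lincomb (monomials deg_mu 1 1) nrc_basis]"
  unfolding indepQ_3_iff
proof (intro allI impI)
  fix g1 g2 g3 assume g: "g1 \<in> subf q 1" "g2 \<in> subf q 1" "g3 \<in> subf q 1"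
    and z: "vadd (vsmul g1 (lincomb (monomials deg_mu 1 0) nrc_basis)) (vadd (vsmul g2 (lincomb (monomials deg_mu 0 1) nrc_basis))
        (vsmul g3 (lincomb (monomials deg_mu 1 1) nrc_basis))) = (0, 0, 0)"
  define cs where "cs = map (\<lambda>i. g1 * monomials deg_mu 1 0 ! i + g2 * monomials deg_mu 0 1 ! i
      + g3 * monomials deg_mu 1 1 ! i) [0..<length nrc_basis]"
  have "lincomb cs nrc_basis = (0, 0, 0)" unfolding cs_def by (subst lincomb_add3) (simp_all add: z)
  moreover have "set cs \<subseteq> subf q 1"
    using g by (auto simp: cs_def intro!: subf_add subf_mult subf_power simp del: upt_Suc)
  moreover have "length cs = length nrc_basis" by (simp add: cs_def)
  ultimately have "set cs \<subseteq> {0}" using indepQ_nrc_basis unfolding indepQ_def by blast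
  moreover have "cs ! i \<in> set cs" if "i < Suc deg_mu" for i
    using that by (simp add: cs_def del: upt_Suc)
  ultimately have "cs ! 0 = 0" "cs ! 1 = 0" "cs ! deg_mu = 0" using deg_mu_ge_2 by force+
  moreover have "cs ! 0 = g1 + g3" "cs ! 1 = g3" "cs ! deg_mu = g2 + g3"
    using deg_mu_ge_2 by (simp_all add: cs_def del: upt_Suc)
  ultimately show "g1 = 0 \<and> g2 = 0 \<and> g3 = 0" by simp
qed

end

context field_qn
begin

lemma external_frame_normalize:
  assumes ind: "indepN A (B::'a vec3)" and ext: "external_linf (subline q 1 A B)"
  obtains \<mu> a1 a2 b1 b2 where "nrc_frame q n p e \<mu> a1 a2 b1 b2"
    "\<And>s t. ptN (lin s (a1, a2, \<mu>) t (b1, b2, 1)) = ptN (lin s A t B)"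
proof -
  have third: "snd (snd (lin s A t B)) \<noteq> 0"
    if "s \<in> subf q 1" "t \<in> subf q 1" "(s, t) \<noteq> (0, 0)" for s t
    using third_nonzero_if_not_on_linf[OF indepN_lin_nonzero[OF ind that(3)]]
      ext ptN_lin_in_subline[OF that] unfolding external_linf_def by blast
  obtain a1 a2 \<alpha> where A: "A = (a1, a2, \<alpha>)" by (cases A)
  obtain b1 b2 \<beta> where B: "B = (b1, b2, \<beta>)" by (cases B)
  have \<beta>: "\<beta> \<noteq> 0" using third[of 0 1] by (simp add: B vsmul_def)
  define \<mu> where "\<mu> = \<alpha> / \<beta>"
  have "\<mu> \<notin> subf q 1"
  proof
    assume "\<mu> \<in> subf q 1"
    hence "snd (snd (lin 1 A (- \<mu>) B)) \<noteq> 0" using third[of 1 "- \<mu>"] by (simp add: subf_minus)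
    thus False using \<beta> by (simp add: third_lin A B \<mu>_def)
  qed
  have scale: "lin s (a1 / \<beta>, a2 / \<beta>, \<mu>) t (b1 / \<beta>, b2 / \<beta>, 1) = vsmul (1 / \<beta>) (lin s A t B)" for s t
    using \<beta> by (simp add: A B \<mu>_def lin_def vsmul_def vadd_def field_simps)
  have "indepN (a1 / \<beta>, a2 / \<beta>, \<mu>) (b1 / \<beta>, b2 / \<beta>, 1)"
    unfolding indepN_lin_iff scale using \<beta> indepN_lin_eq_0[OF ind] by (simp add: vsmul_eq_0_iff)
  with \<open>\<mu> \<notin> subf q 1\<close> show ?thesis
    by (intro that[of \<mu> "a1 / \<beta>" "a2 / \<beta>" "b1 / \<beta>" "b2 / \<beta>"])
      (unfold_locales, simp_all add: scale ptN_vsmul \<beta>)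
qed

lemma is_nrc_phi_subline_1:
  assumes "indepN A (B::'a vec3)" "external_linf (subline q 1 A B)" "n \<le> q"
  shows "is_nrc q (phi q ` subline q 1 A B)"
proof -
  obtain \<mu> a1 a2 b1 b2 where frame: "nrc_frame q n p e \<mu> a1 a2 b1 b2"
    and pt: "\<And>s t. ptN (lin s (a1, a2, \<mu>) t (b1, b2, 1)) = ptN (lin s A t B)"
    using external_frame_normalize[OF assms(1,2)] by blast
  interpret N: nrc_frame q n p e field_type \<mu> a1 a2 b1 b2 by (rule frame)
  have "subline q 1 (a1, a2, \<mu>) (b1, b2, 1) = subline q 1 A B"
    unfolding subline_def using pt[unfolded lin_def] by simp
  hence "phi q ` subline q 1 A B = nrc q N.deg_mu N.nrc_basis" using N.nrc_eq_phi_image by simp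
  thus ?thesis
    unfolding is_nrc_def using N.deg_mu_ge_2 N.deg_mu_le_n assms(3) N.inV_nrc_basis N.indepQ_nrc_basis
    by (intro exI[of _ N.deg_mu] exI[of _ N.nrc_basis]) auto
qed

lemma not_collinear3_phi_frame:
  assumes "indepN A (B::'a vec3)" "external_linf (subline q 1 A B)"
  shows "\<not> collinear3 q (phi q (ptN A)) (phi q (ptN B)) (phi q (ptN (lin 1 A 1 B)))"
proof -
  obtain \<mu> a1 a2 b1 b2 where frame: "nrc_frame q n p e \<mu> a1 a2 b1 b2"
    and pt: "\<And>s t. ptN (lin s (a1, a2, \<mu>) t (b1, b2, 1)) = ptN (lin s A t B)"
    using external_frame_normalize[OF assms] by blast
  interpret N: nrc_frame q n p e field_type \<mu> a1 a2 b1 b2 by (rule frame)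
  have "phi q (ptN (lin s A t B)) = ptS q (lincomb (monomials N.deg_mu s t) N.nrc_basis)"
    if "s \<in> subf q 1" "t \<in> subf q 1" "(s, t) \<noteq> (0, 0)" for s t
    using N.ptS_nrc_point[OF that] pt by simp
  from this[of 1 0] this[of 0 1] this[of 1 1]
  show ?thesis using indepQ_not_collinear3[OF N.indepQ_nrc_frame_points] by simp
qed

lemma phi_external_subline:
  assumes ind: "indepN u (v::'a vec3)" and ext: "external_linf (subline q k u v)" and k: "k dvd n"
  shows "card (phi q ` subline q k u v) = q ^ k + 1"
    and "phi q ` subline q k u v \<subseteq> Sigma_points q"
    and "\<forall>P\<in>phi q ` subline q k u v. affine_Sigma_point q P"
proof -
  have rep: "\<exists>x. P = ptN x \<and> phi q P = ptS q x \<and> snd (snd x) = 1"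
    if P: "P \<in> subline q k u v" for P
  proof -
    obtain x where "P = ptN x" "snd (snd x) = 1" by (rule external_subline_affine[OF ind ext P])
    thus ?thesis using phi_ptN_affine by blast
  qed
  have "inj_on (phi q) (subline q k u v)"
  proof (rule inj_onI)
    fix P P' assume "P \<in> subline q k u v" "P' \<in> subline q k u v" and eq: "phi q P = phi q P'"
    then obtain x x' where "P = ptN x" "phi q P = ptS q x" "snd (snd x) = 1"
      "P' = ptN x'" "phi q P' = ptS q x'" "snd (snd x') = 1"
      using rep by meson
    moreover from this eq have "x = x'" using ptS_affine_inj by simp
    ultimately show "P = P'" by simp
  qed
  thus "card (phi q ` subline q k u v) = q ^ k + 1"
    using card_subline[OF ind k] by (simp add: card_image)
  have "phi q P \<in> Sigma_points q \<and> affine_Sigma_point q (phi q P)" if P: "P \<in> subline q k u v" for P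
  proof -
    obtain x where "phi q P = ptS q x" "snd (snd x) = 1" using rep[OF P] by blast
    moreover have "inV q x" "x \<noteq> (0, 0, 0)" using \<open>snd (snd x) = 1\<close> by (auto simp: inV_def)
    ultimately show ?thesis unfolding Sigma_points_def affine_Sigma_point_def
      by (intro conjI CollectI exI[of _ x]) auto
  qed
  thus "phi q ` subline q k u v \<subseteq> Sigma_points q" "\<forall>P\<in>phi q ` subline q k u v. affine_Sigma_point q P"
    by auto
qed

lemma phi_external_subline_three_points:
  assumes ind: "indepN u (v::'a vec3)" and ext: "external_linf (subline q k u v)"
    and P: "P1 \<in> phi q ` subline q k u v" "P2 \<in> phi q ` subline q k u v" "P3 \<in> phi q ` subline q k u v"
    and dist: "distinct [P1, P2, P3]"
  shows "\<not> collinear3 q P1 P2 P3"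
    and "n \<le> q \<Longrightarrow> \<exists>C. is_nrc q C \<and> C \<subseteq> phi q ` subline q k u v \<and> {P1, P2, P3} \<subseteq> C"
proof -
  obtain Q1 Q2 Q3 where Q: "Q1 \<in> subline q k u v" "Q2 \<in> subline q k u v" "Q3 \<in> subline q k u v"
    and PQ: "P1 = phi q Q1" "P2 = phi q Q2" "P3 = phi q Q3"
    using P by blast
  have "Q1 \<noteq> Q2" "Q1 \<noteq> Q3" "Q2 \<noteq> Q3" using dist PQ by auto
  then obtain A B where AB: "indepN A B" "subline q k A B = subline q k u v"
    "Q1 = ptN A" "Q2 = ptN B" "Q3 = ptN (lin 1 A 1 B)"
    using subline_three_points_frame[OF ind Q] by blast
  have sub: "subline q 1 A B \<subseteq> subline q k u v" using subline_1_subset AB(2) by blast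
  hence ext1: "external_linf (subline q 1 A B)" using ext unfolding external_linf_def by blast
  show "\<not> collinear3 q P1 P2 P3"
    using not_collinear3_phi_frame[OF AB(1) ext1] AB(3-5) PQ by simp
  have "{Q1, Q2, Q3} \<subseteq> subline q 1 A B"
    using AB(3-5) ptN_lin_in_subline[of 1 q 1 0 A B] ptN_lin_in_subline[of 0 q 1 1 A B]
      ptN_lin_in_subline[of 1 q 1 1 A B] by simp
  thus "n \<le> q \<Longrightarrow> \<exists>C. is_nrc q C \<and> C \<subseteq> phi q ` subline q k u v \<and> {P1, P2, P3} \<subseteq> C"
    using is_nrc_phi_subline_1[OF AB(1) ext1] sub PQ
    by (intro exI[of _ "phi q ` subline q 1 A B"]) auto
qed

end

section \<open>Tangent sublines and subspaces of \<Sigma>\<close>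

definition affine_frame :: "'a::field \<Rightarrow> 'a \<Rightarrow> 'a \<Rightarrow> 'a \<Rightarrow> 'a \<Rightarrow> nat \<Rightarrow> 'a vec3 list" where
  "affine_frame a b d1 d2 \<eta> r = (a, b, 1) # map (\<lambda>i. (\<eta> ^ i * d1, \<eta> ^ i * d2, 0)) [0..<r]"

lemma length_affine_frame [simp]: "length (affine_frame a b d1 d2 \<eta> r) = Suc r"
  by (simp add: affine_frame_def)

lemma lincomb_affine_frame:
  assumes "length cs = r"
  shows "lincomb (c # cs) (affine_frame a b d1 d2 \<eta> r) =
    (c * a + power_comb \<eta> cs * d1, c * b + power_comb \<eta> cs * d2, c)"
  using assms
  by (simp add: lincomb_def affine_frame_def power_comb_def sum.lessThan_Suc_shift
      sum_distrib_right mult.assoc del: sum.lessThan_Suc)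

context field_qn
begin

lemma indepQ_affine_frame:
  assumes \<eta>: "\<forall>j. 1 \<le> j \<longrightarrow> j < r \<longrightarrow> (\<eta>::'a) ^ (q ^ j) \<noteq> \<eta>" and d: "(d1, d2) \<noteq> (0, 0)"
  shows "indepQ q (affine_frame a b d1 d2 \<eta> r)"
  unfolding indepQ_def
proof (intro allI impI)
  fix xs :: "'a list"
  assume h: "length xs = length (affine_frame a b d1 d2 \<eta> r) \<and> set xs \<subseteq> subf q 1 \<and>
    lincomb xs (affine_frame a b d1 d2 \<eta> r) = (0, 0, 0)"
  then obtain c cs where xs: "xs = c # cs" "length cs = r" by (cases xs) auto
  hence "(c * a + power_comb \<eta> cs * d1, c * b + power_comb \<eta> cs * d2, c) = (0, 0, 0)"
    using h lincomb_affine_frame[OF xs(2)] by metis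
  hence "c = 0" "power_comb \<eta> cs * d1 = 0" "power_comb \<eta> cs * d2 = 0" by auto
  hence "power_comb \<eta> cs = 0" using d by auto
  thus "set xs \<subseteq> {0}" using power_comb_eq_0_imp[OF \<eta> xs(2)] h xs \<open>c = 0\<close> by simp
qed

lemma subspace_dim_affine_frame:
  assumes "\<forall>j. 1 \<le> j \<longrightarrow> j < r \<longrightarrow> (\<eta>::'a) ^ (q ^ j) \<noteq> \<eta>" "(d1, d2) \<noteq> (0, 0)"
  shows "subspace_dim q r (proj_span q (affine_frame a b d1 d2 \<eta> r))"
  unfolding subspace_dim_def using indepQ_affine_frame[OF assms]
  by (intro exI[of _ "affine_frame a b d1 d2 \<eta> r"]) (auto simp: affine_frame_def inV_def)

lemma spanQ_affine_frame:
  assumes r: "r dvd n" and \<eta>: "\<eta> \<in> subf q r" "\<forall>j. 1 \<le> j \<longrightarrow> j < r \<longrightarrow> (\<eta>::'a) ^ (q ^ j) \<noteq> \<eta>"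
  shows "spanQ q (affine_frame a b d1 d2 \<eta> r) =
    {(c * a + x * d1, c * b + x * d2, c) | c x. c \<in> subf q 1 \<and> x \<in> subf q r}"
proof (intro Set.set_eqI iffI)
  fix w assume "w \<in> spanQ q (affine_frame a b d1 d2 \<eta> r)"
  then obtain xs where xs: "w = lincomb xs (affine_frame a b d1 d2 \<eta> r)"
    "length xs = Suc r" "set xs \<subseteq> subf q 1"
    unfolding spanQ_def by auto
  then obtain c cs where cs: "xs = c # cs" "length cs = r" by (cases xs) auto
  have "power_comb \<eta> cs \<in> power_comb \<eta> ` {cs. set cs \<subseteq> subf q 1 \<and> length cs = r}"
    using xs(3) cs by auto
  hence "power_comb \<eta> cs \<in> subf q r" using power_comb_image[OF r \<eta>] by simp
  moreover have "c \<in> subf q 1" using xs(3) cs(1) by simp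
  moreover have "w = (c * a + power_comb \<eta> cs * d1, c * b + power_comb \<eta> cs * d2, c)"
    using xs(1) cs lincomb_affine_frame[OF cs(2)] by simp
  ultimately show "w \<in> {(c * a + x * d1, c * b + x * d2, c) | c x. c \<in> subf q 1 \<and> x \<in> subf q r}"
    by blast
next
  fix w assume "w \<in> {(c * a + x * d1, c * b + x * d2, c) | c x. c \<in> subf q 1 \<and> x \<in> subf q r}"
  then obtain c x where w: "w = (c * a + x * d1, c * b + x * d2, c)" "c \<in> subf q 1" "x \<in> subf q r"
    by blast
  have "x \<in> power_comb \<eta> ` {cs. set cs \<subseteq> subf q 1 \<and> length cs = r}"
    using power_comb_image[OF r \<eta>] w(3) by simp
  then obtain cs where "set cs \<subseteq> subf q 1" "length cs = r" "x = power_comb \<eta> cs" by blast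
  thus "w \<in> spanQ q (affine_frame a b d1 d2 \<eta> r)"
    unfolding spanQ_def using w lincomb_affine_frame[of cs r c]
    by (intro CollectI exI[of _ "c # cs"]) simp
qed

lemma proj_span_affine_frame_inter_H_inf:
  assumes r: "r dvd n" and \<eta>: "\<eta> \<in> subf q r" "\<forall>j. 1 \<le> j \<longrightarrow> j < r \<longrightarrow> (\<eta>::'a) ^ (q ^ j) \<noteq> \<eta>"
    and d: "(d1, d2) \<noteq> (0, 0)"
  shows "proj_span q (affine_frame a b d1 d2 \<eta> r) \<inter> H_inf_points q =
    {ptS q (d1 * x, d2 * x, 0) | x. x \<in> subf q r \<and> x \<noteq> 0}"
proof (intro Set.set_eqI iffI)
  fix P assume P: "P \<in> proj_span q (affine_frame a b d1 d2 \<eta> r) \<inter> H_inf_points q"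
  then obtain w where "P = ptS q w" "w \<in> spanQ q (affine_frame a b d1 d2 \<eta> r)" "w \<noteq> (0, 0, 0)"
    unfolding proj_span_def by blast
  then obtain c x where w: "P = ptS q (c * a + x * d1, c * b + x * d2, c)" "x \<in> subf q r"
    "(c * a + x * d1, c * b + x * d2, c) \<noteq> (0, 0, 0)"
    unfolding spanQ_affine_frame[OF r \<eta>] by blast
  obtain a' b' where "P = ptS q (a', b', 0)" using P unfolding H_inf_points_def by blast
  hence "ptS q (c * a + x * d1, c * b + x * d2, c) = ptS q (a', b', 0)" using w(1) by simp
  then obtain c' where "c' \<noteq> 0" "(a', b', 0) = vsmul c' (c * a + x * d1, c * b + x * d2, c)"
    using ptS_eqD by blast
  hence "c = 0" by (simp add: vsmul_def)
  hence "P = ptS q (d1 * x, d2 * x, 0)" "x \<noteq> 0" using w by (auto simp: mult.commute)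
  thus "P \<in> {ptS q (d1 * x, d2 * x, 0) | x. x \<in> subf q r \<and> x \<noteq> 0}" using w(2) by blast
next
  fix P assume "P \<in> {ptS q (d1 * x, d2 * x, 0) | x. x \<in> subf q r \<and> x \<noteq> 0}"
  then obtain x where "P = ptS q (d1 * x, d2 * x, 0)" "x \<in> subf q r" "x \<noteq> 0" by blast
  hence x: "P = ptS q (0 * a + x * d1, 0 * b + x * d2, 0)" "x \<in> subf q r" "x \<noteq> 0"
    by (simp_all add: mult.commute)
  have nz: "(0 * a + x * d1, 0 * b + x * d2, 0::'a) \<noteq> (0, 0, 0)" "(x * d1, x * d2) \<noteq> (0, 0)"
    using x(3) d by auto
  have "(0 * a + x * d1, 0 * b + x * d2, 0) \<in> spanQ q (affine_frame a b d1 d2 \<eta> r)"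
    unfolding spanQ_affine_frame[OF r \<eta>] using x(2) by (intro CollectI exI[of _ 0] exI[of _ x]) simp
  hence "P \<in> proj_span q (affine_frame a b d1 d2 \<eta> r)"
    unfolding proj_span_def using x(1) nz(1) by blast
  moreover have "P \<in> Sigma_points q"
    unfolding Sigma_points_def using x(1) nz(1)
    by (intro CollectI exI[of _ "(0 * a + x * d1, 0 * b + x * d2, 0)"]) (simp add: inV_def)
  moreover have "P = ptS q (x * d1, x * d2, 0)" using x(1) by simp
  ultimately show "P \<in> proj_span q (affine_frame a b d1 d2 \<eta> r) \<inter> H_inf_points q"
    unfolding H_inf_points_def using nz(2) by blast
qed

lemma tangent_subline_frame:
  assumes ind: "indepN u (v::'a vec3)" and P0: "P0 \<in> subline q r u v" "on_linf P0"
  obtains U D where "indepN U D" "snd (snd D) = 0" "subline q r U D = subline q r u v"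
proof -
  obtain s0 t0 where st0: "P0 = ptN (lin s0 u t0 v)" "s0 \<in> subf q r" "t0 \<in> subf q r" "(s0, t0) \<noteq> (0, 0)"
    using P0(1) by (rule subline_cases)
  obtain a' b' where "P0 = ptN (a', b', 0)" using P0(2) unfolding on_linf_def by blast
  hence "ptN (lin s0 u t0 v) = ptN (a', b', 0)" using st0(1) by simp
  then obtain c where "c \<noteq> 0" "(a', b', 0) = vsmul c (lin s0 u t0 v)" using ptN_eqD by blast
  hence D: "snd (snd (lin s0 u t0 v)) = 0" by (simp add: vsmul_def)
  obtain s1 t1 where st1: "s1 \<in> subf q r" "t1 \<in> subf q r" "s1 * t0 - s0 * t1 \<noteq> 0"
  proof (cases "t0 = 0")
    case True thus ?thesis using that[of 0 1] st0(4) by simp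
  next
    case False thus ?thesis using that[of 1 0] by simp
  qed
  show ?thesis
  proof (rule that)
    show "indepN (lin s1 u t1 v) (lin s0 u t0 v)" by (rule indepN_lin_frame[OF ind st1(3)])
    show "subline q r (lin s1 u t1 v) (lin s0 u t0 v) = subline q r u v"
      by (rule subline_frame_eq[OF ind st1(1,2) st0(2,3) st1(3)])
  qed (rule D)
qed

text \<open>In the frame U, D of tangent_subline_frame the affine points are ptN (U + \<xi>D).\<close>
lemma tangent_subline_affine_param:
  assumes ind: "indepN u (v::'a vec3)" and tan: "P0 \<in> subline q r u v" "on_linf P0"
    and aff: "P1 \<in> subline q r u v" "\<not> on_linf P1"
  obtains d1 d2 a b where "(d1, d2) \<noteq> (0, 0)"
    "\<And>P. P \<in> subline q r u v \<Longrightarrow> \<not> on_linf P \<Longrightarrow>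
      \<exists>\<xi>\<in>subf q r. phi q P = ptS q (a + \<xi> * d1, b + \<xi> * d2, 1)"
proof -
  obtain U D where UD: "indepN U D" "snd (snd D) = 0" "subline q r U D = subline q r u v"
    using tangent_subline_frame[OF ind tan] .
  obtain U1 U2 u3 where U: "U = (U1, U2, u3)" by (cases U)
  obtain D1 D2 where D: "D = (D1, D2, 0)" using UD(2) by (cases D) auto
  have third: "snd (snd (lin al U be D)) = al * u3" for al be by (simp add: third_lin U D)
  have coords: "\<exists>al be. al \<in> subf q r \<and> be \<in> subf q r \<and> al * u3 \<noteq> 0 \<and> P = ptN (lin al U be D)"
    if P: "P \<in> subline q r u v" "\<not> on_linf P" for P
  proof -
    have "P \<in> subline q r U D" using P(1) UD(3) by simp
    then obtain al be where ab: "P = ptN (lin al U be D)" "al \<in> subf q r" "be \<in> subf q r" "(al, be) \<noteq> (0, 0)"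
      by (rule subline_cases)
    have "al * u3 \<noteq> 0"
      using third[of al be] third_nonzero_if_not_on_linf[OF indepN_lin_nonzero[OF UD(1) ab(4)]] P(2) ab(1)
      by simp
    thus ?thesis using ab by blast
  qed
  have "u3 \<noteq> 0" using coords[OF aff] by auto
  show ?thesis
  proof (rule that[of "D1 / u3" "D2 / u3" "U1 / u3" "U2 / u3"])
    show "(D1 / u3, D2 / u3) \<noteq> (0, 0)" using \<open>u3 \<noteq> 0\<close> UD(1) D indepN_lin_nonzero[of U D 0 1] by auto
  next
    fix P assume "P \<in> subline q r u v" "\<not> on_linf P"
    then obtain al be where P: "al \<in> subf q r" "be \<in> subf q r" "al * u3 \<noteq> 0" "P = ptN (lin al U be D)"
      using coords by blast
    have "P = ptN (vsmul (1 / (al * u3)) (lin al U be D))" using P ptN_vsmul[of "1 / (al * u3)"] by simp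
    also have "vsmul (1 / (al * u3)) (lin al U be D) =
        (U1 / u3 + be / al * (D1 / u3), U2 / u3 + be / al * (D2 / u3), 1)"
      using P(3) by (simp add: U D lin_def vadd_def vsmul_def field_simps)
    finally have "P = ptN (U1 / u3 + be / al * (D1 / u3), U2 / u3 + be / al * (D2 / u3), 1)" .
    thus "\<exists>\<xi>\<in>subf q r. phi q P = ptS q (U1 / u3 + \<xi> * (D1 / u3), U2 / u3 + \<xi> * (D2 / u3), 1)"
      using P(1,2) phi_ptN_affine[of "(U1 / u3 + be / al * (D1 / u3), U2 / u3 + be / al * (D2 / u3), 1)"]
      by (intro bexI[of _ "be / al"]) (simp_all add: subf_divide)
  qed
qed

lemma subspace_through_tangent_subline:
  assumes r: "r dvd n" and ind: "indepN u (v::'a vec3)"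
    and tan: "P0 \<in> subline q r u v" "on_linf P0"
    and m: "m \<subseteq> subline q r u v" "P1 \<in> m" "external_linf m"
  shows "\<exists>S. subspace_dim q r S \<and> phi q ` m \<subseteq> S \<and> D_elem q r (S \<inter> H_inf_points q)"
proof -
  have ext: "\<not> on_linf P" if "P \<in> m" for P using m(3) that unfolding external_linf_def by blast
  have P1: "P1 \<in> subline q r u v" using m(1,2) by blast
  obtain a b d1 d2 where d: "(d1, d2) \<noteq> (0, 0)" and param:
    "\<And>P. P \<in> subline q r u v \<Longrightarrow> \<not> on_linf P \<Longrightarrow>
      \<exists>\<xi>\<in>subf q r. phi q P = ptS q (a + \<xi> * d1, b + \<xi> * d2, 1)"
    using tangent_subline_affine_param[OF ind tan P1 ext[OF m(2)]] by blast
  obtain \<eta> where \<eta>: "\<eta> \<in> subf q r" "\<forall>j. 1 \<le> j \<longrightarrow> j < r \<longrightarrow> (\<eta>::'a) ^ (q ^ j) \<noteq> \<eta>"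
    by (rule ex_subf_generator[OF r])
  let ?S = "proj_span q (affine_frame a b d1 d2 \<eta> r)"
  have "phi q ` m \<subseteq> ?S"
  proof
    fix Q assume "Q \<in> phi q ` m"
    then obtain P where P: "P \<in> m" "Q = phi q P" by blast
    hence "P \<in> subline q r u v" using m(1) by blast
    then obtain \<xi> where "\<xi> \<in> subf q r" "Q = ptS q (1 * a + \<xi> * d1, 1 * b + \<xi> * d2, 1)"
      using param ext[OF P(1)] P(2) by auto
    moreover from this(1) have "(1 * a + \<xi> * d1, 1 * b + \<xi> * d2, 1) \<in> spanQ q (affine_frame a b d1 d2 \<eta> r)"
      unfolding spanQ_affine_frame[OF r \<eta>] by (intro CollectI exI[of _ 1] exI[of _ \<xi>]) simp
    ultimately show "Q \<in> ?S" unfolding proj_span_def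
      by (intro CollectI exI[of _ "(1 * a + \<xi> * d1, 1 * b + \<xi> * d2, 1)"]) simp
  qed
  moreover have "D_elem q r (?S \<inter> H_inf_points q)"
    unfolding proj_span_affine_frame_inter_H_inf[OF r \<eta> d] D_elem_def using d by (intro exI) auto
  ultimately show ?thesis using subspace_dim_affine_frame[OF \<eta>(2) d] by blast
qed

end

theorem corollary2p7:
  fixes q n k r :: nat and m :: "('a::{field,finite}) vec3 set set"
  assumes "\<exists>p e. prime p \<and> e > 0 \<and> q = p ^ e"
    and "n \<ge> 1" and "card (UNIV :: 'a set) = q ^ n"
    and "q \<ge> n" and "k dvd n" and "r dvd n"
    and "is_subline q k m" and "external_linf m"
    and "\<exists>m'. is_subline q r m' \<and> m \<subseteq> m' \<and> tangent_linf m'"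
    and "\<forall>j. j dvd n \<and> (\<exists>m'. is_subline q j m' \<and> m \<subseteq> m' \<and> tangent_linf m') \<longrightarrow> r \<le> j"
  shows "let M = phi q ` m in
      card M = q ^ k + 1 \<and> M \<subseteq> Sigma_points q \<and> (\<forall>P\<in>M. affine_Sigma_point q P)
    \<and> (\<forall>P1\<in>M. \<forall>P2\<in>M. \<forall>P3\<in>M. distinct [P1, P2, P3] \<longrightarrow> \<not> collinear3 q P1 P2 P3)
    \<and> (\<exists>S. subspace_dim q r S \<and> M \<subseteq> S \<and> D_elem q r (S \<inter> H_inf_points q))
    \<and> (\<forall>P1\<in>M. \<forall>P2\<in>M. \<forall>P3\<in>M. distinct [P1, P2, P3] \<longrightarrow>
         (\<exists>C. is_nrc q C \<and> C \<subseteq> M \<and> {P1, P2, P3} \<subseteq> C))"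
proof -
  obtain p e where "prime p" "e > 0" "q = p ^ e" using assms(1) by blast
  then interpret field_qn q n p e "TYPE('a)" by unfold_locales (use assms(2,3) in auto)
  obtain u v where uv: "indepN u v" "m = subline q k u v"
    using assms(7) unfolding is_subline_def by blast
  note ext = assms(8)[unfolded uv(2)]
  obtain m' u' v' where m': "indepN u' v'" "m' = subline q r u' v'" "m \<subseteq> m'" "tangent_linf m'"
    using assms(9) unfolding is_subline_def by blast
  then obtain P0 where "P0 \<in> subline q r u' v'" "on_linf P0" unfolding tangent_linf_def by blast
  moreover obtain P1 where "P1 \<in> m" using card_subline[OF uv(1) assms(5)] uv(2) by fastforce
  ultimately have "\<exists>S. subspace_dim q r S \<and> phi q ` m \<subseteq> S \<and> D_elem q r (S \<inter> H_inf_points q)"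
    using subspace_through_tangent_subline[OF assms(6) m'(1)] m' assms(8) by blast
  moreover have "\<forall>P1\<in>phi q ` m. \<forall>P2\<in>phi q ` m. \<forall>P3\<in>phi q ` m. distinct [P1, P2, P3] \<longrightarrow>
      \<not> collinear3 q P1 P2 P3 \<and> (\<exists>C. is_nrc q C \<and> C \<subseteq> phi q ` m \<and> {P1, P2, P3} \<subseteq> C)"
    unfolding uv(2) using phi_external_subline_three_points[OF uv(1) ext] assms(4) by simp
  ultimately show ?thesis
    using phi_external_subline[OF uv(1) ext assms(5)] unfolding Let_def uv(2) by simp
qed

end
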